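(* Let $x,z\in\{1,\dots,20\}$ (possibly equal), $y\in\{1,\dots,6\}$, let $\mathcal{P}$ and $\mathcal{Q}$ be the $x$-th and $z$-th simple pieces in the list of twenty 1-simple pieces, let $\mathcal{T}=\{B_y\}$, and let $\overline{\mathcal{Q}}$ be the image of $\mathcal{Q}$ under $F_1\circ F_2$. Then for every integer $n\ge 1$, $$s_n(\mathcal{P}\cup\mathcal{T}\cup\overline{\mathcal{Q}})=\sum_{\substack{i+j\le 2m\\ k+l\le 2p\\ m+p=n+1}}P_x(i,j,m)\cdot T_y(i,j,k,l,m,p)\cdot P_z(k,l,p)+s_n(\mathcal{P})+s_n(\mathcal{Q}),$$ where the sum is over positive integers $i,j,k,l,m,p$ satisfying the indicated constraints. Here $P_x(i,j,m)$ is the number of standard puzzles with $m$ columns having the $x$-th simple piece as a support and whose rightmost column has bottom entry $i$ and top entry $i+j$ (and similarly $P_z(k,l,p)$), and $T_y(i,j,k,l,m,p)=Q_y(i,j,k,l,m,p)$, $T_{y+3}(i,j,k,l,m,p)=Q_y(k,l,i,j,p,m)$ for $y\in\{1,2,3\}$, with $$Q_1(i,j,k,l,m,p)=\sum_{\substack{0\le a\le k-1\\0\le b\le j-1}}\binom{i+a-1}{a}\binom{b+k+l-a-1}{b}\binom{2m-i-b+2p-k-l}{2p-k-l},$$ $$Q_2(i,j,k,l,m,p)=\sum_{\substack{0\le a\le k-1\\0\le b\le j-1\\0\le c\le l-1}}\binom{i+a-1}{a}\binom{b+k-a-1}{b}\binom{c+j-b-1}{c}\binom{2m+2p-k-c-i-j}{2m-i-j},$$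 $$Q_3(i,j,k,l,m,p)=\sum_{a=0}^{k-1}\binom{i+j+a-1}{a}\binom{2m+2p-i-j-a}{2p-a}.$$
   Context: A standard piece is a $2\times 2$ matrix whose four entries are $1,2,3,4$, each occurring exactly once. A standard $n$-puzzle is a $2\times(n+1)$ matrix whose entries are $1,2,\dots,2n+2$, each occurring exactly once; its pieces are its $n$ submatrices formed by two consecutive columns. The reduction of a piece is the standard piece obtained by replacing its four distinct entries by $1,2,3,4$ in an order-preserving way. A set $\mathcal{P}$ of standard pieces is a support of a puzzle if the reduction of each piece of the puzzle lies in $\mathcal{P}$. For $n\ge 1$, $S_n(\mathcal{P})$ is the set of standard $n$-puzzles having $\mathcal{P}$ as a support, and $s_n(\mathcal{P})=|S_n(\mathcal{P})|$. In the definition of $P_x(i,j,m)$ the puzzle with $m$ columns has entries $1,\dots,2m$; for $m=1$ the only puzzle considered is the single column with bottom entry $1$ and top entry $2$, so $P_x(1,1,1)=1$. The 24 standard pieces are: $A_1=\left[\begin{smallmatrix}4&3\\1&2\end{smallmatrix}\right]$, $A_2=\left[\begin{smallmatrix}3&4\\1&2\end{smallmatrix}\right]$, $A_3=\left[\begin{smallmatrix}2&4\\1&3\end{smallmatrix}\right]$, $A_4=\left[\begin{smallmatrix}3&4\\2&1\end{smallmatrix}\right]$, $A_5=\left[\begin{smallmatrix}4&3\\2&1\end{smallmatrix}\right]$, $A_6=\left[\begin{smallmatrix}4&2\\3&1\end{smallmatrix}\right]$; $B_1=\left[\begin{smallmatrix}4&2\\1&3\end{smallmatrix}\right]$, $B_2=\left[\begin{smallmatrix}3&2\\1&4\end{smallmatrix}\right]$,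 $B_3=\left[\begin{smallmatrix}2&3\\1&4\end{smallmatrix}\right]$, $B_4=\left[\begin{smallmatrix}3&1\\2&4\end{smallmatrix}\right]$, $B_5=\left[\begin{smallmatrix}4&1\\2&3\end{smallmatrix}\right]$, $B_6=\left[\begin{smallmatrix}4&1\\3&2\end{smallmatrix}\right]$; $C_i$ and $D_i$ are obtained from $B_i$ and $A_i$ respectively by exchanging the top and bottom rows, $1\le i\le 6$. $F_1$ sends $A_i,B_i,C_i,D_i$ to $A_{i+3},C_{i+3},B_{i+3},D_{i+3}$ (subscripts mod 6), i.e. it exchanges the left and right columns of a piece; $F_2$ sends $A_i,B_i,C_i,D_i$ to $D_i,C_i,B_i,A_i$, i.e. it exchanges the top and bottom rows. They are applied to sets of pieces elementwise. The list of the twenty 1-simple pieces: 1. $\{A_1,A_2,A_3,A_4,A_5,A_6\}$; 2. $\{A_3\}$; 3. $\{A_6\}$; 4. $\{A_1,A_2,A_3\}$; 5. $\{A_4,A_5,A_6\}$; 6. $\{A_2,A_3,A_4\}$; 7. $\{A_1,A_5,A_6\}$; 8. $\{A_1,A_2,A_3,A_4,A_5\}$; 9. $\{A_1,A_2,A_4,A_5,A_6\}$; 10. $\{A_1,A_2,A_4,A_5\}$; 11. $\{A_1,A_2\}$; 12. $\{A_4,A_5\}$; 13. $\{A_1,A_5\}$; 14. $\{A_2,A_4\}$; 15. $\{A_4\}$; 16. $\{A_1\}$; 17. $\{A_2,A_3\}$; 18. $\{A_5,A_6\}$; 19. $\{A_2\}$; 20. $\{A_5\}$. *)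

theory Defs
  imports "Jordan_Normal_Form.Matrix"
begin

text \<open>Row \<open>0\<close> of a matrix is the top row and row \<open>1\<close> the bottom row.  Rows and columns are
  indexed from \<open>0\<close>; the indices of the pieces \<open>A\<^sub>i, B\<^sub>i, C\<^sub>i, D\<^sub>i\<close> and of the simple pieces
  start from \<open>1\<close>.\<close>

definition standard_puzzle :: "nat \<Rightarrow> nat mat \<Rightarrow> bool" where
  "standard_puzzle n M \<longleftrightarrow>
     M \<in> carrier_mat 2 (n + 1) \<and>
     bij_betw (\<lambda>rc. M $$ rc) ({..<2} \<times> {..<n + 1}) {1..2 * n + 2}"

definition piece :: "nat mat \<Rightarrow> nat \<Rightarrow> nat mat" where
  "piece M c = mat 2 2 (\<lambda>(r, s). M $$ (r, c + s))"

text \<open>Every entry is replaced by its rank among the entries of the matrix.\<close>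

definition reduction :: "nat mat \<Rightarrow> nat mat" where
  "reduction M = map_mat (\<lambda>e. card {e' \<in> elements_mat M. e' \<le> e}) M"

definition is_support :: "nat mat set \<Rightarrow> nat \<Rightarrow> nat mat \<Rightarrow> bool" where
  "is_support P n M \<longleftrightarrow> (\<forall>c<n. reduction (piece M c) \<in> P)"

text \<open>A \<open>0\<close>-puzzle is a single column; it has no pieces, so every set is a support of it.\<close>

definition S :: "nat \<Rightarrow> nat mat set \<Rightarrow> nat mat set" where
  "S n P = {M. standard_puzzle n M \<and> is_support P n M}"

definition s :: "nat \<Rightarrow> nat mat set \<Rightarrow> nat" where
  "s n P = card (S n P)"

definition F1 :: "nat mat \<Rightarrow> nat mat" where
  "F1 M = mat 2 2 (\<lambda>(r, c). M $$ (r, 1 - c))"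

definition F2 :: "nat mat \<Rightarrow> nat mat" where
  "F2 M = mat 2 2 (\<lambda>(r, c). M $$ (1 - r, c))"

definition A_piece :: "nat \<Rightarrow> nat mat" where
  "A_piece i = mat_of_rows_list 2
     ([[[4, 3],
        [1, 2]],
       [[3, 4],
        [1, 2]],
       [[2, 4],
        [1, 3]],
       [[3, 4],
        [2, 1]],
       [[4, 3],
        [2, 1]],
       [[4, 2],
        [3, 1]]] ! (i - 1))"

definition B_piece :: "nat \<Rightarrow> nat mat" where
  "B_piece i = mat_of_rows_list 2
     ([[[4, 2],
        [1, 3]],
       [[3, 2],
        [1, 4]],
       [[2, 3],
        [1, 4]],
       [[3, 1],
        [2, 4]],
       [[4, 1],
        [2, 3]],
       [[4, 1],
        [3, 2]]] ! (i - 1))"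

definition C_piece :: "nat \<Rightarrow> nat mat" where
  "C_piece i = F2 (B_piece i)"

definition D_piece :: "nat \<Rightarrow> nat mat" where
  "D_piece i = F2 (A_piece i)"

definition simple_piece :: "nat \<Rightarrow> nat mat set" where
  "simple_piece x = A_piece `
     ([{1, 2, 3, 4, 5, 6}, {3}, {6}, {1, 2, 3}, {4, 5, 6},
       {2, 3, 4}, {1, 5, 6}, {1, 2, 3, 4, 5}, {1, 2, 4, 5, 6}, {1, 2, 4, 5},
       {1, 2}, {4, 5}, {1, 5}, {2, 4}, {4},
       {1}, {2, 3}, {5, 6}, {2}, {5}] ! (x - 1))"

text \<open>A puzzle with \<open>m\<close> columns is a standard \<open>(m - 1)\<close>-puzzle.  The single-column convention is
  not built in: for \<open>m = 1\<close> and \<open>j \<ge> 1\<close> it follows from the general formula, see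
  \<open>P_count_one_column\<close>.\<close>

definition P_count :: "nat \<Rightarrow> nat \<Rightarrow> nat \<Rightarrow> nat \<Rightarrow> nat" where
  "P_count x i j m =
     card {M \<in> S (m - 1) (simple_piece x).
             M $$ (1, m - 1) = i \<and> M $$ (0, m - 1) = i + j}"

text \<open>For positive \<open>i, j, k, l, m, p\<close> with \<open>i + j \<le> 2 * m\<close> and \<open>k + l \<le> 2 * p\<close> none of the
  subtractions on \<^typ>\<open>nat\<close> in the following three sums is truncated.\<close>

definition Q1 :: "nat \<Rightarrow> nat \<Rightarrow> nat \<Rightarrow> nat \<Rightarrow> nat \<Rightarrow> nat \<Rightarrow> nat" where
  "Q1 i j k l m p = (\<Sum>a = 0..k - 1. \<Sum>b = 0..j - 1.
     ((i + a - 1) choose a) * ((b + k + l - a - 1) choose b) *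
     (((2 * m - i - b) + (2 * p - k - l)) choose (2 * p - k - l)))"

definition Q2 :: "nat \<Rightarrow> nat \<Rightarrow> nat \<Rightarrow> nat \<Rightarrow> nat \<Rightarrow> nat \<Rightarrow> nat" where
  "Q2 i j k l m p = (\<Sum>a = 0..k - 1. \<Sum>b = 0..j - 1. \<Sum>c = 0..l - 1.
     ((i + a - 1) choose a) * ((b + k - a - 1) choose b) * ((c + j - b - 1) choose c) *
     ((2 * m + 2 * p - k - c - i - j) choose (2 * m - i - j)))"

definition Q3 :: "nat \<Rightarrow> nat \<Rightarrow> nat \<Rightarrow> nat \<Rightarrow> nat \<Rightarrow> nat \<Rightarrow> nat" where
  "Q3 i j k l m p = (\<Sum>a = 0..k - 1.
     ((i + j + a - 1) choose a) * ((2 * m + 2 * p - i - j - a) choose (2 * p - a)))"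

definition Q :: "nat \<Rightarrow> nat \<Rightarrow> nat \<Rightarrow> nat \<Rightarrow> nat \<Rightarrow> nat \<Rightarrow> nat \<Rightarrow> nat" where
  "Q y = [Q1, Q2, Q3] ! (y - 1)"

definition T :: "nat \<Rightarrow> nat \<Rightarrow> nat \<Rightarrow> nat \<Rightarrow> nat \<Rightarrow> nat \<Rightarrow> nat \<Rightarrow> nat" where
  "T y i j k l m p = (if y \<le> 3 then Q y i j k l m p else Q (y - 3) k l i j p m)"

definition sum_indices :: "nat \<Rightarrow> (nat \<times> nat \<times> nat \<times> nat \<times> nat \<times> nat) set" where
  "sum_indices n = {(i, j, k, l, m, p).
     0 < i \<and> 0 < j \<and> 0 < k \<and> 0 < l \<and> 0 < m \<and> 0 < p \<and>
     i + j \<le> 2 * m \<and> k + l \<le> 2 * p \<and> m + p = n + 1}"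

lemma finite_sum_indices: "finite (sum_indices n)"
proof (rule finite_subset)
  let ?N = "{..2 * n + 2}"
  show "sum_indices n \<subseteq> ?N \<times> ?N \<times> ?N \<times> ?N \<times> ?N \<times> ?N"
    by (auto simp: sum_indices_def)
qed auto

lemma less_two_cases: "(i::nat) < 2 \<longleftrightarrow> i = 0 \<or> i = 1"
  by auto

lemma one_to_six: "i \<in> {1..6} \<longleftrightarrow> i = 1 \<or> i = 2 \<or> i = 3 \<or> i = 4 \<or> i = 5 \<or> i = (6::nat)"
  by auto

lemma F2_pieces:
  assumes "i \<in> {1..6}"
  shows "F2 (A_piece i) = D_piece i" "F2 (B_piece i) = C_piece i"
    "F2 (C_piece i) = B_piece i" "F2 (D_piece i) = A_piece i"
  using assms unfolding one_to_six
  by (auto simp: F2_def A_piece_def B_piece_def C_piece_def D_piece_def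
      mat_of_rows_list_def less_two_cases less_Suc_eq intro!: eq_matI)

lemma F1_pieces:
  assumes "i \<in> {1..3}"
  shows "F1 (A_piece i) = A_piece (i + 3)" "F1 (A_piece (i + 3)) = A_piece i"
    "F1 (B_piece i) = C_piece (i + 3)" "F1 (B_piece (i + 3)) = C_piece i"
    "F1 (C_piece i) = B_piece (i + 3)" "F1 (C_piece (i + 3)) = B_piece i"
    "F1 (D_piece i) = D_piece (i + 3)" "F1 (D_piece (i + 3)) = D_piece i"
proof -
  have "i = 1 \<or> i = 2 \<or> i = 3"
    using assms by auto
  then show "F1 (A_piece i) = A_piece (i + 3)" "F1 (A_piece (i + 3)) = A_piece i"
    "F1 (B_piece i) = C_piece (i + 3)" "F1 (B_piece (i + 3)) = C_piece i"
    "F1 (C_piece i) = B_piece (i + 3)" "F1 (C_piece (i + 3)) = B_piece i"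
    "F1 (D_piece i) = D_piece (i + 3)" "F1 (D_piece (i + 3)) = D_piece i"
    by (auto simp: F1_def F2_def A_piece_def B_piece_def C_piece_def D_piece_def
        mat_of_rows_list_def less_two_cases less_Suc_eq intro!: eq_matI)
qed

lemma P_count_one_column:
  assumes "0 < i" "0 < j"
  shows "P_count x i j 1 = (if i = 1 \<and> j = 1 then 1 else 0)"
proof -
  let ?X = "{M \<in> S 0 (simple_piece x). M $$ (1, 0) = i \<and> M $$ (0, 0) = i + j}"
  let ?M = "mat 2 1 (\<lambda>(r, c). 2 - r) :: nat mat"
  have ij: "i = 1 \<and> j = 1" and eq: "M = ?M" if "M \<in> ?X" for M
  proof -
    have M: "M \<in> carrier_mat 2 1" "bij_betw (\<lambda>rc. M $$ rc) ({..<2} \<times> {..<1}) {1..2}"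
      "M $$ (1, 0) = i" "M $$ (0, 0) = i + j"
      using that by (auto simp: S_def standard_puzzle_def numeral_2_eq_2)
    have "M $$ (0, 0) \<in> {1..2}"
      by (rule bij_betw_apply[OF M(2)]) auto
    then show ij: "i = 1 \<and> j = 1"
      using M assms by auto
    show "M = ?M"
      using M ij by (auto simp: less_two_cases less_Suc_eq intro!: eq_matI)
  qed
  have "bij_betw (\<lambda>rc. ?M $$ rc) ({..<2} \<times> {..<1}) {1..2}"
    by (rule bij_betw_byWitness[where f' = "\<lambda>e. (2 - e, 0)"])
      (auto simp: numeral_2_eq_2 le_Suc_eq less_Suc_eq)
  then have "?M \<in> S 0 (simple_piece x)"
    by (simp add: S_def is_support_def standard_puzzle_def numeral_2_eq_2)
  then have "?X = (if i = 1 \<and> j = 1 then {?M} else {})"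
    using ij eq by auto
  then show ?thesis
    by (simp add: P_count_def)
qed

end

theory Submission
  imports Defs
begin

text \<open>A puzzle is encoded as the list of its cells in increasing order of their entries.  Reducing a
  piece then amounts to filtering the list by two columns, and joining a puzzle with \<open>m\<close> columns
  to one with \<open>p\<close> columns amounts to shuffling two lists.

  In a piece \<open>A\<^sub>i\<close> both columns have the smaller entry at the bottom, in a piece of
  \<open>(F1 \<circ> F2) ` simple_piece z\<close> both have it at the top, and \<open>B\<^sub>y\<close> is a transition from the
  first kind of column to the second.  Hence a puzzle with the given support consists of \<open>m\<close> columns
  of the first kind followed by \<open>p\<close> of the second, with exactly one piece \<open>B\<^sub>y\<close> between them
  unless \<open>m = 0\<close> or \<open>p = 0\<close>; these two cases contribute the two last summands.  The second part,
  turned by 180 degrees, is a puzzle supported by the \<open>z\<close>-th simple piece.  For fixed parts, the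
  number of shuffles in which the four entries next to the transition are ordered as in
  \<open>B\<^sub>y\<close> only depends on their ranks \<open>i\<close>, \<open>i + j\<close>, \<open>k\<close>, \<open>k + l\<close> within the two parts.
  Cutting a shuffle at the cells in question gives the binomial sums.\<close>

subsection \<open>Positions in lists\<close>

text \<open>Positions count from 0, so in the encoding an entry is \<open>Suc\<close> of the
  position of its cell. For an element that does not occur the value is
  \<open>length xs\<close>.\<close>

definition pos :: "'a list \<Rightarrow> 'a \<Rightarrow> nat" where
  "pos xs x = length (takeWhile (\<lambda>y. y \<noteq> x) xs)"

lemma pos_Cons: "pos (y # xs) x = (if y = x then 0 else Suc (pos xs x))"
  by (simp add: pos_def)

lemma pos_append: "pos (xs @ ys) x = (if x \<in> set xs then pos xs x else length xs + pos ys x)"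
  by (induction xs) (auto simp: pos_def)

lemma pos_less_length: "x \<in> set xs \<Longrightarrow> pos xs x < length xs"
  by (induction xs) (auto simp: pos_Cons)

lemma nth_pos: "x \<in> set xs \<Longrightarrow> xs ! pos xs x = x"
  by (induction xs) (auto simp: pos_Cons)

lemma pos_nth: "distinct xs \<Longrightarrow> i < length xs \<Longrightarrow> pos xs (xs ! i) = i"
  by (metis nth_mem nth_pos nth_eq_iff_index_eq pos_less_length)

lemma pos_inj: "x \<in> set xs \<Longrightarrow> y \<in> set xs \<Longrightarrow> pos xs x = pos xs y \<Longrightarrow> x = y"
  by (metis nth_pos)

lemma pos_map: "inj_on f A \<Longrightarrow> set xs \<subseteq> A \<Longrightarrow> x \<in> A \<Longrightarrow> pos (map f xs) (f x) = pos xs x"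
  by (induction xs) (auto simp: pos_def dest: inj_onD)

text \<open>Comparisons survive passing to a sublist; this carries order conditions between a
  shuffle, its two parts and its pieces.\<close>

lemma pos_filter_less:
  "P x \<Longrightarrow> P y \<Longrightarrow> x \<in> set xs \<Longrightarrow> y \<in> set xs \<Longrightarrow>
    pos (filter P xs) x < pos (filter P xs) y \<longleftrightarrow> pos xs x < pos xs y"
proof (induction xs)
  case (Cons a xs)
  have *: "z \<in> set xs" if "a \<noteq> z" "z = x \<or> z = y" for z
    using Cons.prems that by auto
  show ?case
    using Cons.IH Cons.prems(1,2) * by (auto simp: pos_Cons)
qed simp

text \<open>The right-hand side is the rank that \<open>reduction\<close> assigns, so filtering a
  list performs the reduction.\<close>

lemma Suc_pos_filter:
  "distinct xs \<Longrightarrow> P x \<Longrightarrow> x \<in> set xs \<Longrightarrow>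
    Suc (pos (filter P xs) x) = card {y \<in> set xs. P y \<and> pos xs y \<le> pos xs x}"
proof (induction xs)
  case (Cons a xs)
  show ?case
  proof (cases "a = x")
    case True
    then have "{y \<in> set (a # xs). P y \<and> pos (a # xs) y \<le> pos (a # xs) x} = {x}"
      using Cons.prems by (auto simp: pos_Cons split: if_splits)
    then show ?thesis
      using True Cons.prems by (simp add: pos_Cons)
  next
    case False
    let ?X = "{y \<in> set xs. P y \<and> pos xs y \<le> pos xs x}"
    have "{y \<in> set (a # xs). P y \<and> pos (a # xs) y \<le> pos (a # xs) x}
        = (if P a then insert a ?X else ?X)"
      using False Cons.prems by (auto simp: pos_Cons split: if_splits)
    moreover have "a \<notin> ?X"
      using Cons.prems by auto
    ultimately show ?thesis
      using False Cons by (simp add: pos_Cons)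
  qed
qed simp

lemma pos_eq_imp_eq:
  assumes "distinct xs" "distinct ys" "set xs = set ys" "\<And>x. x \<in> set xs \<Longrightarrow> pos xs x = pos ys x"
  shows "xs = ys"
proof (rule nth_equalityI)
  show len: "length xs = length ys"
    using assms by (metis distinct_card)
  show "xs ! i = ys ! i" if "i < length xs" for i
    using that assms len by (metis nth_mem nth_pos pos_nth)
qed

subsection \<open>Shuffles with prescribed comparisons\<close>

lemma append_in_shuffles:
  "u \<in> shuffles l1 r1 \<Longrightarrow> v \<in> shuffles l2 r2 \<Longrightarrow> u @ v \<in> shuffles (l1 @ l2) (r1 @ r2)"
proof (induction u arbitrary: l1 r1)
  case (Cons z u)
  from Cons.prems(1) consider l1' where "l1 = z # l1'" "u \<in> shuffles l1' r1"
    | r1' where "r1 = z # r1'" "u \<in> shuffles l1 r1'"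
    by (cases l1; cases r1) auto
  then show ?case
    by cases (use Cons in \<open>auto simp: Cons_in_shuffles_leftI Cons_in_shuffles_rightI\<close>)
qed simp

text \<open>Converse of \<open>append_in_shuffles\<close>: a shuffle keeps the order of
  \<open>r\<close>, so the elements of \<open>r\<close> read before \<open>c\<close> form a
  prefix.\<close>

lemma shuffles_append_ConsE:
  assumes "zs \<in> shuffles (l1 @ c # l2) r"
  obtains a u v where "a \<le> length r" "zs = u @ c # v"
    "u \<in> shuffles l1 (take a r)" "v \<in> shuffles l2 (drop a r)"
proof -
  have "\<exists>a u v. a \<le> length r \<and> zs = u @ c # v \<and>
      u \<in> shuffles l1 (take a r) \<and> v \<in> shuffles l2 (drop a r)"
    using assms
  proof (induction zs arbitrary: l1 r)
    case (Cons z zs)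
    \<comment> \<open>The head is \<open>c\<close> itself, or comes from \<open>l1\<close>, or comes
      from \<open>r\<close>; only the last case increases \<open>a\<close>.\<close>
    from Cons.prems consider
        "l1 = []" "z = c" "zs \<in> shuffles l2 r"
      | l1' where "l1 = z # l1'" "zs \<in> shuffles (l1' @ c # l2) r"
      | r' where "r = z # r'" "zs \<in> shuffles (l1 @ c # l2) r'"
      by (cases l1; cases r) auto
    then show ?case
    proof cases
      case 1
      then show ?thesis
        by (intro exI[of _ 0] exI[of _ "[]"] exI[of _ zs]) simp
    next
      case 2
      from Cons.IH[OF 2(2)] obtain a u v where "a \<le> length r" "zs = u @ c # v"
        "u \<in> shuffles l1' (take a r)" "v \<in> shuffles l2 (drop a r)"
        by blast
      with 2 show ?thesis
        by (intro exI[of _ a] exI[of _ "z # u"] exI[of _ v]) (auto simp: Cons_in_shuffles_leftI)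
    next
      case 3
      from Cons.IH[OF 3(2)] obtain a u v where "a \<le> length r'" "zs = u @ c # v"
        "u \<in> shuffles l1 (take a r')" "v \<in> shuffles l2 (drop a r')"
        by blast
      with 3 show ?thesis
        by (intro exI[of _ "Suc a"] exI[of _ "z # u"] exI[of _ v])
          (auto simp: Cons_in_shuffles_rightI)
    qed
  qed simp
  then show thesis
    using that by blast
qed

text \<open>The summation index \<open>a\<close> is the number of elements of the second list that precede \<open>c\<close>.\<close>

lemma card_shuffles_before:
  assumes dist: "distinct (l1 @ c # l2 @ r1 @ d # r2)"
    and P: "\<And>u v. set u \<subseteq> set l1 \<union> set r1 \<Longrightarrow> P (u @ c # v) \<longleftrightarrow> P v"
  shows "card {zs \<in> shuffles (l1 @ c # l2) (r1 @ d # r2). pos zs c < pos zs d \<and> P zs} =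
    (\<Sum>a = 0..length r1. ((length l1 + a) choose a) *
       card {v \<in> shuffles l2 (drop a r1 @ d # r2). P v})"
proof -
  let ?r = "r1 @ d # r2"
  let ?W = "{zs \<in> shuffles (l1 @ c # l2) ?r. pos zs c < pos zs d \<and> P zs}"
  \<comment> \<open>\<open>u\<close> is what precedes \<open>c\<close> and \<open>v\<close> what
    follows. As \<open>P\<close> depends on \<open>v\<close> alone, it restricts only the second
    factor, and further cuts can be made in \<open>v\<close>.\<close>
  let ?B = "\<lambda>a. shuffles l1 (take a r1) \<times> {v \<in> shuffles l2 (drop a r1 @ d # r2). P v}"
  let ?f = "\<lambda>(a, u, v). u @ c # v"
  have set_u: "set u \<subseteq> set l1 \<union> set r1" "length u = length l1 + a"
    if "u \<in> shuffles l1 (take a r1)" "a \<le> length r1" for a u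
    using set_shuffles[OF that(1)] length_shuffles[OF that(1)] that(2)
    by (auto dest: in_set_takeD)
  have c_u: "c \<notin> set u" "d \<notin> set u" if "u \<in> shuffles l1 (take a r1)" "a \<le> length r1" for a u
    using set_u(1)[OF that] dist by auto
  have inj: "inj_on ?f (SIGMA a:{0..length r1}. ?B a)"
  proof (rule inj_onI)
    fix t t'
    assume "t \<in> (SIGMA a:{0..length r1}. ?B a)" "t' \<in> (SIGMA a:{0..length r1}. ?B a)" "?f t = ?f t'"
    moreover obtain a u v a' u' v' where t: "t = (a, u, v)" "t' = (a', u', v')"
      by (metis prod_cases3)
    ultimately have *: "a \<le> length r1" "a' \<le> length r1" "u \<in> shuffles l1 (take a r1)"
      "u' \<in> shuffles l1 (take a' r1)" "u @ c # v = u' @ c # v'"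
      by auto
    \<comment> \<open>Neither \<open>u\<close> nor \<open>u'\<close> contains \<open>c\<close>, so
      both cuts are at the first occurrence of \<open>c\<close>; the length of \<open>u\<close> then
      gives \<open>a\<close>.\<close>
    have uv: "u = u' \<and> v = v'"
      using *(5) c_u(1)[OF *(3,1)] c_u(1)[OF *(4,2)] by (auto simp: append_eq_append_conv2 append_eq_Cons_conv Cons_eq_append_conv)
    then have "a = a'"
      using set_u(2)[OF *(3,1)] set_u(2)[OF *(4,2)] by simp
    then show "t = t'"
      using t uv by simp
  qed
  have img: "?f ` (SIGMA a:{0..length r1}. ?B a) = ?W"
  proof (intro equalityI subsetI)
    fix zs assume "zs \<in> ?f ` (SIGMA a:{0..length r1}. ?B a)"
    then obtain a u v where *: "a \<le> length r1" "u \<in> shuffles l1 (take a r1)"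
      "v \<in> shuffles l2 (drop a r1 @ d # r2)" "P v" "zs = u @ c # v"
      by auto
    have u: "set u \<subseteq> set l1 \<union> set r1"
      using set_u * by blast
    have "c \<noteq> d"
      using dist by auto
    then have "pos zs c < pos zs d"
      using c_u[OF *(2,1)] by (simp add: * pos_append pos_Cons)
    moreover have "zs \<in> shuffles (l1 @ c # l2) (take a r1 @ drop a r1 @ d # r2)"
      unfolding * by (rule append_in_shuffles[OF *(2)]) (use * in \<open>auto simp: Cons_in_shuffles_iff\<close>)
    ultimately show "zs \<in> ?W"
      using P[OF u] * by (simp add: append_assoc[symmetric] del: append_assoc)
  next
    fix zs assume "zs \<in> ?W"
    then have zs: "zs \<in> shuffles (l1 @ c # l2) ?r" "pos zs c < pos zs d" "P zs"
      by auto
    obtain a u v where *: "a \<le> length ?r" "zs = u @ c # v"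
      "u \<in> shuffles l1 (take a ?r)" "v \<in> shuffles l2 (drop a ?r)"
      using zs(1) by (rule shuffles_append_ConsE)
    have "c \<notin> set u"
      using set_shuffles[OF *(3)] dist by (auto dest!: in_set_takeD)
    then have "d \<notin> set u"
      using zs(2) pos_less_length[of d u] by (auto simp: * pos_append pos_Cons)
    \<comment> \<open>If the cut went beyond \<open>r1\<close>, then \<open>d\<close> would be read
      before \<open>c\<close>.\<close>
    have a: "a \<le> length r1"
    proof (rule ccontr)
      assume "\<not> a \<le> length r1"
      then have "d \<in> set (take a ?r)"
        by (cases "a - length r1") auto
      then show False
        using set_shuffles[OF *(3)] \<open>d \<notin> set u\<close> by blast
    qed
    then have **: "u \<in> shuffles l1 (take a r1)" "v \<in> shuffles l2 (drop a r1 @ d # r2)"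
      using *(3,4) by simp_all
    have "P v"
      using zs(3) P[OF set_u(1)[OF **(1) a], of v] *(2) by simp
    then show "zs \<in> ?f ` (SIGMA a:{0..length r1}. ?B a)"
      using a * ** by (intro image_eqI[where x = "(a, u, v)"]) auto
  qed
  have "card ?W = card (SIGMA a:{0..length r1}. ?B a)"
    by (simp only: img[symmetric] card_image[OF inj])
  also have "\<dots> = (\<Sum>a = 0..length r1. card (?B a))"
    by (rule card_SigmaI) auto
  also have "\<dots> = (\<Sum>a = 0..length r1. ((length l1 + a) choose a) *
      card {v \<in> shuffles l2 (drop a r1 @ d # r2). P v})"
  proof (rule sum.cong[OF refl])
    fix a assume "a \<in> {0..length r1}"
    moreover have "set l1 \<inter> set (take a r1) = {}"
      using dist by (auto dest!: in_set_takeD)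
    \<comment> \<open>Choosing the places of the \<open>a\<close> elements instead of those of
      \<open>l1\<close> gives the binomials the form they have in \<open>Q1\<close>,
      \<open>Q2\<close> and \<open>Q3\<close>.\<close>
    ultimately have "card (shuffles l1 (take a r1)) = (length l1 + a) choose a"
      by (simp add: card_disjoint_shuffles) (metis add.commute add_diff_cancel_left' binomial_symmetric le_add2)
    then show "card (?B a) = ((length l1 + a) choose a) *
      card {v \<in> shuffles l2 (drop a r1 @ d # r2). P v}"
      by (simp add: card_cartesian_product)
  qed
  finally show ?thesis .
qed

text \<open>Without a further condition the tail is an arbitrary shuffle;
  \<open>Suc (length r2)\<close> counts \<open>d\<close> together with \<open>r2\<close>.\<close>

lemma card_shuffles_before_simple:
  assumes "distinct (l1 @ c # l2 @ r1 @ d # r2)"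
  shows "card {zs \<in> shuffles (l1 @ c # l2) (r1 @ d # r2). pos zs c < pos zs d} =
    (\<Sum>a = 0..length r1. ((length l1 + a) choose a) *
       ((length l2 + (length r1 - a) + Suc (length r2)) choose (length l2)))"
proof -
  have "card (shuffles l2 (drop a r1 @ d # r2)) =
      (length l2 + (length r1 - a) + Suc (length r2)) choose (length l2)" for a
    using assms by (subst card_disjoint_shuffles) (auto dest!: in_set_dropD simp: add_ac)
  then show ?thesis
    using card_shuffles_before[OF assms, of "\<lambda>_. True"] by simp
qed

section \<open>Iterated cuts and the three binomial sums\<close>

lemma distinct_mset_eq: "distinct xs \<Longrightarrow> mset xs = mset ys \<Longrightarrow> distinct ys"
  using mset_eq_imp_distinct_iff by blast

lemma distinct_drop_append: "distinct (xs @ ys) \<Longrightarrow> distinct (drop n xs @ ys)"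
  by (auto dest: in_set_dropD)

text \<open>In the first list \<open>\<alpha>\<close> and \<open>\<beta>\<close> have ranks
  \<open>i\<close> and \<open>i + j\<close>, in the second \<open>\<gamma>\<close> and
  \<open>\<delta>\<close> have ranks \<open>k\<close> and \<open>k + l\<close>. One cut at
  \<open>\<beta>\<close> suffices: \<open>a\<close> elements of \<open>r1\<close> precede it, and
  the rest is a free shuffle.\<close>

lemma card_shuffles_Q3:
  assumes dist: "distinct (l1 @ \<alpha> # l2 @ \<beta> # l3 @ r1 @ \<gamma> # r2 @ \<delta> # r3)"
    and len: "length l1 = i - 1" "length l2 = j - 1" "length l3 = 2 * m - i - j"
      "length r1 = k - 1" "length r2 = l - 1" "length r3 = 2 * p - k - l"
    and pos: "0 < i" "0 < j" "0 < k" "0 < l" "i + j \<le> 2 * m" "k + l \<le> 2 * p"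
  shows "card {zs \<in> shuffles (l1 @ \<alpha> # l2 @ \<beta> # l3) (r1 @ \<gamma> # r2 @ \<delta> # r3).
    pos zs \<beta> < pos zs \<gamma>} = Q3 i j k l m p"
proof -
  have "card {zs \<in> shuffles ((l1 @ \<alpha> # l2) @ \<beta> # l3) (r1 @ \<gamma> # r2 @ \<delta> # r3).
    pos zs \<beta> < pos zs \<gamma>} = Q3 i j k l m p"
    unfolding Q3_def
  proof (subst card_shuffles_before_simple)
    show "(\<Sum>a = 0..length r1. ((length (l1 @ \<alpha> # l2) + a) choose a) *
       ((length l3 + (length r1 - a) + Suc (length (r2 @ \<delta> # r3))) choose (length l3))) =
      (\<Sum>a = 0..k - 1. ((i + j + a - 1) choose a) * ((2 * m + 2 * p - i - j - a) choose (2 * p - a)))"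
    proof (rule sum.cong)
      fix a assume a: "a \<in> {0..k - 1}"
      have 1: "length (l1 @ \<alpha> # l2) + a = i + j + a - 1"
        using pos by (simp add: len)
      have 2: "length l3 + (length r1 - a) + Suc (length (r2 @ \<delta> # r3)) = 2 * m + 2 * p - i - j - a"
        using pos a by (simp add: len)
      \<comment> \<open>The sum \<open>Q3\<close> uses the complementary lower index, hence this
        difference and \<open>binomial_symmetric\<close>.\<close>
      have 3: "length l3 = (2 * m + 2 * p - i - j - a) - (2 * p - a)"
        using pos a by (simp add: len)
      show "((length (l1 @ \<alpha> # l2) + a) choose a) *
       ((length l3 + (length r1 - a) + Suc (length (r2 @ \<delta> # r3))) choose (length l3)) =
       ((i + j + a - 1) choose a) * ((2 * m + 2 * p - i - j - a) choose (2 * p - a))"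
        unfolding 1 2 unfolding 3 by (subst binomial_symmetric[symmetric]) (use pos in auto)
    qed (simp add: len)
  qed (use dist in auto)
  then show ?thesis
    by simp
qed

text \<open>Two cuts: first at \<open>\<alpha>\<close>, preceded by \<open>a\<close> elements of
  \<open>r1\<close>, then at \<open>\<delta>\<close>, preceded by \<open>b\<close> elements of
  \<open>l2\<close>. The first cut leaves all of \<open>l2\<close>, \<open>\<beta>\<close>,
  \<open>\<gamma>\<close> and \<open>\<delta>\<close> in the tail.\<close>

lemma card_shuffles_Q1:
  assumes dist: "distinct (l1 @ \<alpha> # l2 @ \<beta> # l3 @ r1 @ \<gamma> # r2 @ \<delta> # r3)"
    and len: "length l1 = i - 1" "length l2 = j - 1" "length l3 = 2 * m - i - j"
      "length r1 = k - 1" "length r2 = l - 1" "length r3 = 2 * p - k - l"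
    and pos: "0 < i" "0 < j" "0 < k" "0 < l" "i + j \<le> 2 * m" "k + l \<le> 2 * p"
  shows "card {zs \<in> shuffles (l1 @ \<alpha> # l2 @ \<beta> # l3) (r1 @ \<gamma> # r2 @ \<delta> # r3).
    pos zs \<alpha> < pos zs \<gamma> \<and> pos zs \<delta> < pos zs \<beta>} = Q1 i j k l m p"
proof -
  have dist': "distinct (l2 @ \<beta> # l3 @ r1 @ \<gamma> # r2 @ \<delta> # r3)"
    using dist by simp
  have inner: "card {v \<in> shuffles (l2 @ \<beta> # l3) (drop a r1 @ \<gamma> # r2 @ \<delta> # r3).
      pos v \<delta> < pos v \<beta>} = (\<Sum>b = 0..j - 1. ((b + k + l - a - 1) choose b) *
       (((2 * m - i - b) + (2 * p - k - l)) choose (2 * p - k - l)))" (is "card ?V = _")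
    if a: "a \<in> {0..k - 1}" for a
  proof -
    \<comment> \<open>The cut element is now \<open>\<delta>\<close>, so the lists swap roles and
      all of \<open>drop a r1 @ \<gamma> # r2\<close> lies before it.\<close>
    have "card ?V = card {v \<in> shuffles ((drop a r1 @ \<gamma> # r2) @ \<delta> # r3) (l2 @ \<beta> # l3). pos v \<delta> < pos v \<beta>}"
      by (simp add: shuffles_commutes)
    also have "\<dots> = (\<Sum>b = 0..length l2. ((length (drop a r1 @ \<gamma> # r2) + b) choose b) *
       ((length r3 + (length l2 - b) + Suc (length l3)) choose (length r3)))"
    proof (rule card_shuffles_before_simple)
      have "distinct (r1 @ \<gamma> # r2 @ \<delta> # r3 @ l2 @ \<beta> # l3)"
        using dist' by (rule distinct_mset_eq) simp
      from distinct_drop_append[OF this]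
      show "distinct ((drop a r1 @ \<gamma> # r2) @ \<delta> # r3 @ l2 @ \<beta> # l3)"
        by simp
    qed
    also have "\<dots> = (\<Sum>b = 0..j - 1. ((b + k + l - a - 1) choose b) *
       (((2 * m - i - b) + (2 * p - k - l)) choose (2 * p - k - l)))"
    proof (rule sum.cong)
      fix b assume b: "b \<in> {0..j - 1}"
      have 1: "length (drop a r1 @ \<gamma> # r2) + b = b + k + l - a - 1"
        using pos a by (simp add: len)
      have 2: "length r3 + (length l2 - b) + Suc (length l3) = (2 * m - i - b) + (2 * p - k - l)"
        using pos b by (simp add: len)
      show "((length (drop a r1 @ \<gamma> # r2) + b) choose b) *
         ((length r3 + (length l2 - b) + Suc (length l3)) choose (length r3)) =
         ((b + k + l - a - 1) choose b) *
         (((2 * m - i - b) + (2 * p - k - l)) choose (2 * p - k - l))"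
        unfolding 1 2 by (simp add: len)
    qed (simp add: len)
    finally show ?thesis .
  qed
  \<comment> \<open>Neither \<open>\<beta>\<close> nor \<open>\<delta>\<close> occurs in
    \<open>u @ [\<alpha>]\<close>, so both positions drop by the same amount.\<close>
  have P: "pos (u @ \<alpha> # v) \<delta> < pos (u @ \<alpha> # v) \<beta> \<longleftrightarrow> pos v \<delta> < pos v \<beta>"
    if "set u \<subseteq> set l1 \<union> set r1" for u v
    using that dist by (auto simp: pos_append pos_Cons)
  have d: "distinct (l1 @ \<alpha> # (l2 @ \<beta> # l3) @ r1 @ \<gamma> # (r2 @ \<delta> # r3))"
    using dist by simp
  note before = card_shuffles_before[where P = "\<lambda>zs. pos zs \<delta> < pos zs \<beta>", OF d P]
  have "card {zs \<in> shuffles (l1 @ \<alpha> # l2 @ \<beta> # l3) (r1 @ \<gamma> # r2 @ \<delta> # r3).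
      pos zs \<alpha> < pos zs \<gamma> \<and> pos zs \<delta> < pos zs \<beta>} =
    (\<Sum>a = 0..length r1. ((length l1 + a) choose a) *
      card {v \<in> shuffles (l2 @ \<beta> # l3) (drop a r1 @ \<gamma> # r2 @ \<delta> # r3). pos v \<delta> < pos v \<beta>})"
    by (rule before)
  also have "\<dots> = Q1 i j k l m p"
    unfolding Q1_def len(4)
  proof (rule sum.cong[OF refl])
    fix a assume a: "a \<in> {0..k - 1}"
    have "length l1 + a = i + a - 1"
      using pos by (simp add: len)
    then show "((length l1 + a) choose a) *
        card {v \<in> shuffles (l2 @ \<beta> # l3) (drop a r1 @ \<gamma> # r2 @ \<delta> # r3). pos v \<delta> < pos v \<beta>} =
      (\<Sum>b = 0..j - 1. ((i + a - 1) choose a) * ((b + k + l - a - 1) choose b) *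
       (((2 * m - i - b) + (2 * p - k - l)) choose (2 * p - k - l)))"
      unfolding inner[OF a] by (simp add: sum_distrib_left mult.assoc)
  qed
  finally show ?thesis .
qed

text \<open>Three cuts at \<open>\<alpha>\<close>, \<open>\<gamma>\<close> and
  \<open>\<beta>\<close>, alternating between the lists: they are preceded by \<open>a\<close>
  elements of \<open>r1\<close>, \<open>b\<close> elements of \<open>l2\<close> and \<open>c\<close>
  elements of \<open>r2\<close> respectively.\<close>

lemma card_shuffles_Q2:
  assumes dist: "distinct (l1 @ \<alpha> # l2 @ \<beta> # l3 @ r1 @ \<gamma> # r2 @ \<delta> # r3)"
    and len: "length l1 = i - 1" "length l2 = j - 1" "length l3 = 2 * m - i - j"
      "length r1 = k - 1" "length r2 = l - 1" "length r3 = 2 * p - k - l"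
    and pos: "0 < i" "0 < j" "0 < k" "0 < l" "i + j \<le> 2 * m" "k + l \<le> 2 * p"
  shows "card {zs \<in> shuffles (l1 @ \<alpha> # l2 @ \<beta> # l3) (r1 @ \<gamma> # r2 @ \<delta> # r3).
    pos zs \<alpha> < pos zs \<gamma> \<and> pos zs \<gamma> < pos zs \<beta> \<and> pos zs \<beta> < pos zs \<delta>} = Q2 i j k l m p"
proof -
  have dist': "distinct (l2 @ \<beta> # l3 @ r1 @ \<gamma> # r2 @ \<delta> # r3)"
    using dist by simp
  \<comment> \<open>The sum is built from the inside: this is the last cut, at
    \<open>\<beta>\<close>, in the tail left by the cuts at \<open>\<alpha>\<close> and
    \<open>\<gamma>\<close>.\<close>
  have inner2: "card {w \<in> shuffles (r2 @ \<delta> # r3) (drop b l2 @ \<beta> # l3). pos w \<beta> < pos w \<delta>} =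
      (\<Sum>c = 0..l - 1. ((c + j - b - 1) choose c) *
         ((2 * m + 2 * p - k - c - i - j) choose (2 * m - i - j)))" (is "card ?V = _")
    if b: "b \<in> {0..j - 1}" for b
  proof -
    have "card ?V = card {w \<in> shuffles (drop b l2 @ \<beta> # l3) (r2 @ \<delta> # r3). pos w \<beta> < pos w \<delta>}"
      by (simp add: shuffles_commutes)
    also have "\<dots> = (\<Sum>c = 0..length r2. ((length (drop b l2) + c) choose c) *
       ((length l3 + (length r2 - c) + Suc (length r3)) choose (length l3)))"
    proof (rule card_shuffles_before_simple)
      have "distinct (r1 @ \<gamma> # l2 @ \<beta> # l3 @ r2 @ \<delta> # r3)"
        using dist' by (rule distinct_mset_eq) simp
      then have "distinct (l2 @ \<beta> # l3 @ r2 @ \<delta> # r3)"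
        by simp
      from distinct_drop_append[OF this]
      show "distinct (drop b l2 @ \<beta> # l3 @ r2 @ \<delta> # r3)" .
    qed
    also have "\<dots> = (\<Sum>c = 0..l - 1. ((c + j - b - 1) choose c) *
         ((2 * m + 2 * p - k - c - i - j) choose (2 * m - i - j)))"
    proof (rule sum.cong)
      fix c assume c: "c \<in> {0..l - 1}"
      have 1: "length (drop b l2) + c = c + j - b - 1"
        using pos b by (simp add: len)
      have 2: "length l3 + (length r2 - c) + Suc (length r3) = 2 * m + 2 * p - k - c - i - j"
        using pos c by (simp add: len)
      show "((length (drop b l2) + c) choose c) *
         ((length l3 + (length r2 - c) + Suc (length r3)) choose (length l3)) =
         ((c + j - b - 1) choose c) *
         ((2 * m + 2 * p - k - c - i - j) choose (2 * m - i - j))"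
        unfolding 1 2 by (simp add: len)
    qed (simp add: len)
    finally show ?thesis .
  qed
  have inner: "card {v \<in> shuffles (l2 @ \<beta> # l3) (drop a r1 @ \<gamma> # r2 @ \<delta> # r3).
      pos v \<gamma> < pos v \<beta> \<and> pos v \<beta> < pos v \<delta>} =
      (\<Sum>b = 0..j - 1. ((b + k - a - 1) choose b) * (\<Sum>c = 0..l - 1. ((c + j - b - 1) choose c) *
         ((2 * m + 2 * p - k - c - i - j) choose (2 * m - i - j))))" (is "card ?V = _")
    if a: "a \<in> {0..k - 1}" for a
  proof -
    have P: "pos (u @ \<gamma> # v) \<beta> < pos (u @ \<gamma> # v) \<delta> \<longleftrightarrow> pos v \<beta> < pos v \<delta>"
      if "set u \<subseteq> set (drop a r1) \<union> set l2" for u v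
    proof -
      have "set u \<subseteq> set r1 \<union> set l2"
        using that set_drop_subset[of a r1] by blast
      then have "\<beta> \<notin> set u" "\<delta> \<notin> set u" "\<gamma> \<noteq> \<beta>" "\<gamma> \<noteq> \<delta>"
        using dist by auto
      then show ?thesis
        by (simp add: pos_append pos_Cons)
    qed
    have "distinct (r1 @ \<gamma> # (r2 @ \<delta> # r3) @ l2 @ \<beta> # l3)"
      using dist' by (rule distinct_mset_eq) simp
    then have d: "distinct (drop a r1 @ \<gamma> # (r2 @ \<delta> # r3) @ l2 @ \<beta> # l3)"
      by (rule distinct_drop_append)
    have "card ?V = card {v \<in> shuffles (drop a r1 @ \<gamma> # r2 @ \<delta> # r3) (l2 @ \<beta> # l3).
      pos v \<gamma> < pos v \<beta> \<and> pos v \<beta> < pos v \<delta>}"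
      by (simp add: shuffles_commutes)
    also have "\<dots> = (\<Sum>b = 0..length l2. ((length (drop a r1) + b) choose b) *
      card {w \<in> shuffles (r2 @ \<delta> # r3) (drop b l2 @ \<beta> # l3). pos w \<beta> < pos w \<delta>})"
      by (rule card_shuffles_before[where P = "\<lambda>w. pos w \<beta> < pos w \<delta>", OF d P])
    also have "\<dots> = (\<Sum>b = 0..j - 1. ((b + k - a - 1) choose b) *
       (\<Sum>c = 0..l - 1. ((c + j - b - 1) choose c) *
         ((2 * m + 2 * p - k - c - i - j) choose (2 * m - i - j))))"
      unfolding len(2)
    proof (rule sum.cong[OF refl])
      fix b assume b: "b \<in> {0..j - 1}"
      have 1: "length (drop a r1) + b = b + k - a - 1"
        using pos a by (simp add: len)
      show "((length (drop a r1) + b) choose b) *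
        card {w \<in> shuffles (r2 @ \<delta> # r3) (drop b l2 @ \<beta> # l3). pos w \<beta> < pos w \<delta>} =
        ((b + k - a - 1) choose b) * (\<Sum>c = 0..l - 1. ((c + j - b - 1) choose c) *
         ((2 * m + 2 * p - k - c - i - j) choose (2 * m - i - j)))"
        unfolding inner2[OF b] 1 ..
    qed
    finally show ?thesis .
  qed
  have P: "pos (u @ \<alpha> # v) \<gamma> < pos (u @ \<alpha> # v) \<beta> \<and> pos (u @ \<alpha> # v) \<beta> < pos (u @ \<alpha> # v) \<delta> \<longleftrightarrow>
      pos v \<gamma> < pos v \<beta> \<and> pos v \<beta> < pos v \<delta>"
    if "set u \<subseteq> set l1 \<union> set r1" for u v
    using that dist by (auto simp: pos_append pos_Cons)
  have d: "distinct (l1 @ \<alpha> # (l2 @ \<beta> # l3) @ r1 @ \<gamma> # (r2 @ \<delta> # r3))"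
    using dist by simp
  note before = card_shuffles_before[
      where P = "\<lambda>zs. pos zs \<gamma> < pos zs \<beta> \<and> pos zs \<beta> < pos zs \<delta>", OF d P]
  have "card {zs \<in> shuffles (l1 @ \<alpha> # l2 @ \<beta> # l3) (r1 @ \<gamma> # r2 @ \<delta> # r3).
      pos zs \<alpha> < pos zs \<gamma> \<and> pos zs \<gamma> < pos zs \<beta> \<and> pos zs \<beta> < pos zs \<delta>} =
    (\<Sum>a = 0..length r1. ((length l1 + a) choose a) *
      card {v \<in> shuffles (l2 @ \<beta> # l3) (drop a r1 @ \<gamma> # r2 @ \<delta> # r3).
        pos v \<gamma> < pos v \<beta> \<and> pos v \<beta> < pos v \<delta>})"
    by (rule before)
  also have "\<dots> = Q2 i j k l m p"
    unfolding Q2_def len(4)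
  proof (rule sum.cong[OF refl])
    fix a assume a: "a \<in> {0..k - 1}"
    have "length l1 + a = i + a - 1"
      using pos by (simp add: len)
    then show "((length l1 + a) choose a) *
        card {v \<in> shuffles (l2 @ \<beta> # l3) (drop a r1 @ \<gamma> # r2 @ \<delta> # r3).
          pos v \<gamma> < pos v \<beta> \<and> pos v \<beta> < pos v \<delta>} =
      (\<Sum>b = 0..j - 1. \<Sum>c = 0..l - 1. ((i + a - 1) choose a) * ((b + k - a - 1) choose b) *
       ((c + j - b - 1) choose c) *
       ((2 * m + 2 * p - k - c - i - j) choose (2 * m - i - j)))"
      unfolding inner[OF a] by (simp add: sum_distrib_left mult.assoc)
  qed
  finally show ?thesis .
qed

section \<open>The six order patterns of the transition piece\<close>

lemma split_at_two:
  assumes "x \<in> set xs" "y \<in> set xs" "pos xs x < pos xs y"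
  obtains us vs ws where "xs = us @ x # vs @ y # ws"
    "length us = pos xs x" "length vs = pos xs y - pos xs x - 1"
proof -
  obtain us xs' where 1: "xs = us @ x # xs'" "x \<notin> set us"
    using assms(1) by (meson split_list_first)
  then have "y \<in> set xs'"
    using assms pos_less_length[of y us] by (auto simp: pos_append pos_Cons split: if_splits)
  then obtain vs ws where 2: "xs' = vs @ y # ws" "y \<notin> set vs"
    by (meson split_list_first)
  have "y \<notin> set us" "y \<noteq> x"
    using assms(3) 1 pos_less_length[of y us] by (auto simp: pos_append pos_Cons)
  then show thesis
    using that[of us vs ws] 1 2 by (simp add: pos_append pos_Cons)
qed

text \<open>The arguments \<open>a, b, c, d\<close> are the bottom left, top left, top right and bottom right cell of
  a piece with \<open>f a < f b\<close> and \<open>f c < f d\<close>; the condition says that it reduces to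
  \<open>B_piece y\<close>.\<close>

definition B_order :: "nat \<Rightarrow> ('a \<Rightarrow> nat) \<Rightarrow> 'a \<Rightarrow> 'a \<Rightarrow> 'a \<Rightarrow> 'a \<Rightarrow> bool" where
  "B_order y f a b c d \<longleftrightarrow>
     [f a < f c \<and> f d < f b, f a < f c \<and> f c < f b \<and> f b < f d, f b < f c,
      f c < f a \<and> f b < f d, f c < f a \<and> f a < f d \<and> f d < f b, f d < f a] ! (y - 1)"

lemma B_order_cong:
  "(f a < f c \<longleftrightarrow> g a' < g c') \<Longrightarrow> (f c < f a \<longleftrightarrow> g c' < g a') \<Longrightarrow>
   (f a < f d \<longleftrightarrow> g a' < g d') \<Longrightarrow> (f d < f a \<longleftrightarrow> g d' < g a') \<Longrightarrow>
   (f b < f c \<longleftrightarrow> g b' < g c') \<Longrightarrow> (f c < f b \<longleftrightarrow> g c' < g b') \<Longrightarrow>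
   (f b < f d \<longleftrightarrow> g b' < g d') \<Longrightarrow> (f d < f b \<longleftrightarrow> g d' < g b') \<Longrightarrow>
   B_order y f a b c d \<longleftrightarrow> B_order y g a' b' c' d'"
  by (simp add: B_order_def)

text \<open>\<open>split_at_two\<close> turns positions into the block lengths of the three binomial
  counts; \<open>Suc\<close> converts positions to ranks counted from 1.\<close>

lemma card_shuffles_B_order_upto3:
  assumes "distinct (xs @ ys)" "length xs = 2 * m" "length ys = 2 * p"
    and "a \<in> set xs" "b \<in> set xs" "pos xs a < pos xs b"
    and "c \<in> set ys" "d \<in> set ys" "pos ys c < pos ys d"
    and "y \<in> {1..3}"
  shows "card {zs \<in> shuffles xs ys. B_order y (pos zs) a b c d} =
    Q y (Suc (pos xs a)) (pos xs b - pos xs a) (Suc (pos ys c)) (pos ys d - pos ys c) m p"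
proof -
  obtain l1 l2 l3 where l: "xs = l1 @ a # l2 @ b # l3"
    "length l1 = pos xs a" "length l2 = pos xs b - pos xs a - 1"
    using split_at_two[OF assms(4,5,6)] by blast
  obtain r1 r2 r3 where r: "ys = r1 @ c # r2 @ d # r3"
    "length r1 = pos ys c" "length r2 = pos ys d - pos ys c - 1"
    using split_at_two[OF assms(7,8,9)] by blast
  let ?i = "Suc (pos xs a)" and ?j = "pos xs b - pos xs a"
  let ?k = "Suc (pos ys c)" and ?l = "pos ys d - pos ys c"
  have dist: "distinct (l1 @ a # l2 @ b # l3 @ r1 @ c # r2 @ d # r3)"
    using assms(1) unfolding l(1) r(1) by simp
  have "length l1 + length l2 + length l3 + 2 = 2 * m"
    using assms(2) arg_cong[OF l(1), of length] by simp
  then have l3: "length l3 = 2 * m - ?i - ?j" and ij: "?i + ?j \<le> 2 * m"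
    using l(2,3) assms(6) by linarith+
  have "length r1 + length r2 + length r3 + 2 = 2 * p"
    using assms(3) arg_cong[OF r(1), of length] by simp
  then have r3: "length r3 = 2 * p - ?k - ?l" and kl: "?k + ?l \<le> 2 * p"
    using r(2,3) assms(9) by linarith+
  have len: "length l1 = ?i - 1" "length r1 = ?k - 1"
    using l(2) r(2) by simp_all
  have pos: "0 < ?i" "0 < ?j" "0 < ?k" "0 < ?l"
    using assms by simp_all
  note hyps = dist len(1) l(3) l3 len(2) r(3) r3 pos ij kl
  have "y = 1 \<or> y = 2 \<or> y = 3"
    using assms(10) by auto
  then show ?thesis
    using card_shuffles_Q1[OF hyps] card_shuffles_Q2[OF hyps] card_shuffles_Q3[OF hyps]
    by (elim disjE) (simp_all add: B_order_def Q_def l(1)[symmetric] r(1)[symmetric])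
qed

text \<open>The patterns 4 to 6 are the patterns 1 to 3 with the two columns interchanged, just as
  \<open>T\<close> interchanges the arguments of \<open>Q\<close>; shuffles are symmetric in the two
  lists.\<close>

lemma card_shuffles_B_order:
  assumes "distinct (xs @ ys)" "length xs = 2 * m" "length ys = 2 * p"
    and "a \<in> set xs" "b \<in> set xs" "pos xs a < pos xs b"
    and "c \<in> set ys" "d \<in> set ys" "pos ys c < pos ys d"
    and "y \<in> {1..6}"
  shows "card {zs \<in> shuffles xs ys. B_order y (pos zs) a b c d} =
    T y (Suc (pos xs a)) (pos xs b - pos xs a) (Suc (pos ys c)) (pos ys d - pos ys c) m p"
proof (cases "y \<le> 3")
  case True
  then show ?thesis
    using card_shuffles_B_order_upto3[OF assms(1-9), of y] assms(10) by (simp add: T_def)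
next
  case False
  then have y: "y - 3 \<in> {1..3}" and "y = 4 \<or> y = 5 \<or> y = 6"
    using assms(10) by auto
  then have "B_order y f a b c d \<longleftrightarrow> B_order (y - 3) f c d a b" for f :: "'a \<Rightarrow> nat"
    by (auto simp: B_order_def)
  moreover have "distinct (ys @ xs)"
    using assms(1) by auto
  ultimately show ?thesis
    using card_shuffles_B_order_upto3[OF _ assms(3,2,7-9,4-6) y] False
    by (simp add: T_def shuffles_commutes[of xs])
qed

subsection \<open>Puzzles as lists of cells\<close>

definition cell_lists :: "nat \<Rightarrow> (nat \<times> nat) list set" where
  "cell_lists m = {xs. distinct xs \<and> set xs = {..<2} \<times> {..<m}}"

definition puzzle_of :: "nat \<Rightarrow> (nat \<times> nat) list \<Rightarrow> nat mat" where
  "puzzle_of n xs = mat 2 (n + 1) (\<lambda>rc. Suc (pos xs rc))"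

lemma puzzle_of_carrier [simp]: "puzzle_of n xs \<in> carrier_mat 2 (Suc n)"
  by (simp add: puzzle_of_def)

lemma puzzle_of_index [simp]:
  "r < 2 \<Longrightarrow> c \<le> n \<Longrightarrow> puzzle_of n xs $$ (r, c) = Suc (pos xs (r, c))"
  by (simp add: puzzle_of_def)

lemma length_cell_lists: "xs \<in> cell_lists m \<Longrightarrow> length xs = 2 * m"
  by (auto simp: cell_lists_def distinct_card[symmetric])

lemma finite_cell_lists [simp]: "finite (cell_lists m)"
proof (rule finite_subset)
  show "cell_lists m \<subseteq> {xs. set xs \<subseteq> {..<2} \<times> {..<m} \<and> length xs \<le> 2 * m}"
    by (auto simp: length_cell_lists) (auto simp: cell_lists_def)
  show "finite {xs. set xs \<subseteq> {..<2::nat} \<times> {..<m} \<and> length xs \<le> 2 * m}"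
    by (rule finite_lists_length_le) simp
qed

lemma standard_puzzle_of:
  assumes "xs \<in> cell_lists (n + 1)"
  shows "standard_puzzle n (puzzle_of n xs)"
proof -
  have xs: "distinct xs" "set xs = {..<2} \<times> {..<n + 1}"
    using assms by (auto simp: cell_lists_def)
  have "bij_betw (\<lambda>rc. Suc (pos xs rc)) (set xs) {1..2 * n + 2}"
    unfolding bij_betw_def
  proof
    show "inj_on (\<lambda>rc. Suc (pos xs rc)) (set xs)"
      by (rule inj_onI) (simp add: pos_inj)
    show "(\<lambda>rc. Suc (pos xs rc)) ` set xs = {1..2 * n + 2}"
    proof (intro equalityI subsetI)
      fix v assume v: "v \<in> {1..2 * n + 2}"
      then have "v = Suc (pos xs (xs ! (v - 1)))" "xs ! (v - 1) \<in> set xs"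
        using length_cell_lists[OF assms] pos_nth[OF xs(1), of "v - 1"] by auto
      then show "v \<in> (\<lambda>rc. Suc (pos xs rc)) ` set xs"
        by blast
    next
      fix v assume "v \<in> (\<lambda>rc. Suc (pos xs rc)) ` set xs"
      then obtain rc where "rc \<in> set xs" "v = Suc (pos xs rc)"
        by blast
      then show "v \<in> {1..2 * n + 2}"
        using length_cell_lists[OF assms] pos_less_length[of rc xs] by simp
    qed
  qed
  moreover have "bij_betw (\<lambda>rc. puzzle_of n xs $$ rc) (set xs) {1..2 * n + 2} \<longleftrightarrow>
      bij_betw (\<lambda>rc. Suc (pos xs rc)) (set xs) {1..2 * n + 2}"
    by (rule bij_betw_cong) (auto simp: xs)
  ultimately show ?thesis
    by (simp add: standard_puzzle_def xs)
qed

lemma ex_puzzle_of: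
  assumes "standard_puzzle n M"
  shows "M \<in> puzzle_of n ` cell_lists (n + 1)"
proof -
  let ?C = "{..<2::nat} \<times> {..<n + 1}" and ?V = "{1..2 * n + 2}"
  let ?f = "\<lambda>rc. M $$ rc"
  have M: "M \<in> carrier_mat 2 (n + 1)" "bij_betw ?f ?C ?V"
    using assms by (auto simp: standard_puzzle_def)
  \<comment> \<open>The cells in the order of their entries, from 1 to \<open>2 * n + 2\<close>,
    read off through the inverse of the indexing bijection.\<close>
  define xs where "xs = map (inv_into ?C ?f) [1..<2 * n + 3]"
  have set_V: "set [1..<2 * n + 3] = ?V"
    by auto
  have inv: "bij_betw (inv_into ?C ?f) ?V ?C"
    using M(2) by (rule bij_betw_inv_into)
  have xs: "distinct xs" "set xs = ?C"
    using inv unfolding xs_def bij_betw_def distinct_map set_map set_V by simp_all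
  have "Suc (pos xs rc) = M $$ rc" if "rc \<in> ?C" for rc
  proof -
    have v: "M $$ rc \<in> ?V"
      using M(2) that by (rule bij_betw_apply)
    then have len: "M $$ rc - 1 < length [1..<2 * n + 3]"
      by (auto simp del: upt_Suc)
    have "xs ! (M $$ rc - 1) = inv_into ?C ?f ([1..<2 * n + 3] ! (M $$ rc - 1))"
      unfolding xs_def by (rule nth_map[OF len])
    also have "[1..<2 * n + 3] ! (M $$ rc - 1) = M $$ rc"
      using v len by (subst nth_upt) auto
    also have "inv_into ?C ?f (M $$ rc) = rc"
      using bij_betw_inv_into_left[OF M(2) that] .
    finally have "xs ! (M $$ rc - 1) = rc" .
    moreover have "M $$ rc - 1 < length xs"
      using len by (simp add: xs_def)
    ultimately have "pos xs rc = M $$ rc - 1"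
      using pos_nth[OF xs(1), of "M $$ rc - 1"] by simp
    then show ?thesis
      using v by simp
  qed
  then have "M = puzzle_of n xs"
    using M(1) by (intro eq_matI) (auto simp: puzzle_of_def)
  then show ?thesis
    using xs by (auto simp: cell_lists_def)
qed

lemma inj_on_puzzle_of: "inj_on (puzzle_of n) (cell_lists (n + 1))"
proof (rule inj_onI)
  fix xs ys assume *: "xs \<in> cell_lists (n + 1)" "ys \<in> cell_lists (n + 1)"
    "puzzle_of n xs = puzzle_of n ys"
  have "pos xs (r, c) = pos ys (r, c)" if "r < 2" "c < n + 1" for r c
    using arg_cong[OF *(3), of "\<lambda>M. M $$ (r, c)"] that by simp
  then show "xs = ys"
    using * by (intro pos_eq_imp_eq) (auto simp: cell_lists_def)
qed

text \<open>Encodes the reduced piece at \<open>c\<close>, as \<open>reduction_puzzle_of\<close>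
  shows: filtering keeps the relative order, and the two columns are renumbered 0 and 1.\<close>

definition column_pair :: "nat \<Rightarrow> (nat \<times> nat) list \<Rightarrow> (nat \<times> nat) list" where
  "column_pair c xs = map (\<lambda>(r, t). (r, t - c)) (filter (\<lambda>rc. snd rc \<in> {c, Suc c}) xs)"

lemma inj_on_shift: "inj_on (\<lambda>(r, t). (r, t - c)) {rc :: nat \<times> nat. c \<le> snd rc}"
  by (auto simp: inj_on_def)

lemma column_pair_in_cell_lists:
  assumes "xs \<in> cell_lists m" "Suc c < m"
  shows "column_pair c xs \<in> cell_lists 2"
proof -
  have "(\<lambda>(r, t). (r, t - c)) ` {rc \<in> {..<2} \<times> {..<m}. snd rc \<in> {c, Suc c}} = {..<2} \<times> {..<2::nat}"
    (is "?f ` ?A = ?B")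
  proof (intro equalityI subsetI)
    fix rc assume "rc \<in> ?B"
    then have "rc = ?f (fst rc, c + snd rc)" "(fst rc, c + snd rc) \<in> ?A"
      using assms(2) by auto
    then show "rc \<in> ?f ` ?A"
      by blast
  qed auto
  moreover have "inj_on ?f {rc \<in> set xs. snd rc \<in> {c, Suc c}}"
    by (rule inj_on_subset[OF inj_on_shift]) auto
  ultimately show ?thesis
    using assms(1) by (simp add: cell_lists_def column_pair_def distinct_map)
qed

lemma pos_column_pair:
  assumes "t < 2"
  shows "pos (column_pair c xs) (r, t) = pos (filter (\<lambda>rc. snd rc \<in> {c, Suc c}) xs) (r, c + t)"
proof -
  have "pos (column_pair c xs) ((\<lambda>(r, t). (r, t - c)) (r, c + t)) =
    pos (filter (\<lambda>rc. snd rc \<in> {c, Suc c}) xs) (r, c + t)"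
    unfolding column_pair_def by (rule pos_map[OF inj_on_shift]) auto
  then show ?thesis
    by simp
qed

lemma pos_column_pair_less:
  assumes "xs \<in> cell_lists m" "Suc c < m" "r < 2" "r' < 2" "t < 2" "t' < 2"
  shows "pos (column_pair c xs) (r, t) < pos (column_pair c xs) (r', t') \<longleftrightarrow>
    pos xs (r, c + t) < pos xs (r', c + t')"
proof -
  have "(r, c + t) \<in> set xs" "(r', c + t') \<in> set xs"
    using assms by (simp_all add: cell_lists_def)
  moreover have "snd (r, c + t) \<in> {c, Suc c}" "snd (r', c + t') \<in> {c, Suc c}"
    using assms(5,6) by (auto simp: less_two_cases)
  ultimately show ?thesis
    unfolding pos_column_pair[OF assms(5)] pos_column_pair[OF assms(6)]
    by (simp only: pos_filter_less[where P = "\<lambda>rc. snd rc \<in> {c, Suc c}"])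
qed

text \<open>The rank of an entry within the piece is the number of cells of the two columns that
  occur no later in \<open>xs\<close>, which \<open>Suc_pos_filter\<close> reads off the filtered
  list.\<close>

lemma reduction_puzzle_of:
  assumes xs: "xs \<in> cell_lists (n + 1)" and c: "c < n"
  shows "reduction (piece (puzzle_of n xs) c) = puzzle_of 1 (column_pair c xs)"
proof (rule eq_matI)
  let ?M = "piece (puzzle_of n xs) c"
  let ?C = "{rc \<in> set xs. snd rc \<in> {c, Suc c}}"
  fix r t assume "r < dim_row (puzzle_of 1 (column_pair c xs))"
    "t < dim_col (puzzle_of 1 (column_pair c xs))"
  then have rt: "r < 2" "t < 2"
    by (simp_all add: puzzle_of_def)
  have M: "?M \<in> carrier_mat 2 2"
    by (simp add: piece_def)
  have M_index: "?M $$ (r', t') = Suc (pos xs (r', c + t'))" if "r' < 2" "t' < 2" for r' t'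
    using that c by (simp add: piece_def)
  have elements: "elements_mat ?M = (\<lambda>rc. Suc (pos xs rc)) ` ?C"
  proof (intro equalityI subsetI)
    fix e assume "e \<in> elements_mat ?M"
    then have "\<exists>r' t'. r' < dim_row ?M \<and> t' < dim_col ?M \<and> e = ?M $$ (r', t')"
      by (rule elements_matD)
    then obtain r' t' where e: "r' < 2" "t' < 2" "e = ?M $$ (r', t')"
      unfolding carrier_matD[OF M] by (elim exE conjE)
    have "t' = 0 \<or> t' = 1"
      using e(2) by auto
    then have "(r', c + t') \<in> ?C"
      by (elim disjE) (use e(1) c xs in \<open>simp_all add: cell_lists_def\<close>)
    then show "e \<in> (\<lambda>rc. Suc (pos xs rc)) ` ?C"
      using e M_index by blast
  next
    fix e assume "e \<in> (\<lambda>rc. Suc (pos xs rc)) ` ?C"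
    then obtain rc where rc: "rc \<in> ?C" "e = Suc (pos xs rc)"
      by blast
    obtain r' t' where rt': "rc = (r', t')"
      by (cases rc)
    have t': "t' - c < 2" "c + (t' - c) = t'"
      using rc(1) unfolding rt' by auto
    have r': "r' < 2"
      using rc(1) xs unfolding rt' by (simp add: cell_lists_def)
    have "e = ?M $$ (r', t' - c)"
      unfolding M_index[OF r' t'(1)] t'(2) rc(2) rt' ..
    then show "e \<in> elements_mat ?M"
      by (rule elements_matI[OF M r' t'(1)])
  qed
  let ?X = "{rc \<in> set xs. snd rc \<in> {c, Suc c} \<and> pos xs rc \<le> pos xs (r, c + t)}"
  have "reduction ?M $$ (r, t) = card {e \<in> elements_mat ?M. e \<le> Suc (pos xs (r, c + t))}"
    using rt M by (simp add: reduction_def M_index)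
  also have "{e \<in> elements_mat ?M. e \<le> Suc (pos xs (r, c + t))} = (\<lambda>rc. Suc (pos xs rc)) ` ?X"
    unfolding elements by auto
  also have "card \<dots> = card ?X"
  proof (rule card_image, rule inj_onI)
    fix u v assume "u \<in> ?X" "v \<in> ?X" "Suc (pos xs u) = Suc (pos xs v)"
    then show "u = v"
      using pos_inj[of u xs v] by blast
  qed
  also have "\<dots> = Suc (pos (column_pair c xs) (r, t))"
  proof -
    have "(r, c + t) \<in> set xs" "distinct xs"
      using rt xs c by (simp_all add: cell_lists_def)
    moreover have "snd (r, c + t) \<in> {c, Suc c}"
      using rt(2) by auto
    ultimately show ?thesis
      unfolding pos_column_pair[OF rt(2)]
      by (simp only: Suc_pos_filter[where P = "\<lambda>rc. snd rc \<in> {c, Suc c}"])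
  qed
  finally show "reduction ?M $$ (r, t) = puzzle_of 1 (column_pair c xs) $$ (r, t)"
    using rt by simp
qed (simp_all add: reduction_def piece_def puzzle_of_def)

section \<open>Supports and counts in terms of lists\<close>

definition support_lists :: "nat mat set \<Rightarrow> nat \<Rightarrow> (nat \<times> nat) list set" where
  "support_lists P m =
     {xs \<in> cell_lists m. \<forall>c. Suc c < m \<longrightarrow> puzzle_of 1 (column_pair c xs) \<in> P}"

lemma finite_support_lists [simp]: "finite (support_lists P m)"
  by (simp add: support_lists_def)

lemma support_lists_subset: "support_lists P m \<subseteq> cell_lists m"
  by (auto simp: support_lists_def)

text \<open>\<open>ex_puzzle_of\<close> supplies an encoding of each puzzle; together with
  \<open>inj_on_puzzle_of\<close> this transfers all counts to lists.\<close>

lemma S_eq: "S n P = puzzle_of n ` support_lists P (n + 1)"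
proof -
  have supp: "is_support P n (puzzle_of n xs) \<longleftrightarrow> xs \<in> support_lists P (n + 1)"
    if "xs \<in> cell_lists (n + 1)" for xs
    using that by (simp add: is_support_def support_lists_def reduction_puzzle_of)
  show ?thesis
  proof (intro equalityI subsetI)
    fix M assume "M \<in> S n P"
    then have M: "standard_puzzle n M" "is_support P n M"
      by (simp_all add: S_def)
    obtain xs where "M = puzzle_of n xs" "xs \<in> cell_lists (n + 1)"
      using ex_puzzle_of[OF M(1)] by (rule imageE)
    then show "M \<in> puzzle_of n ` support_lists P (n + 1)"
      using supp M(2) by simp
  next
    fix M assume "M \<in> puzzle_of n ` support_lists P (n + 1)"
    then obtain xs where xs: "M = puzzle_of n xs" "xs \<in> support_lists P (n + 1)"
      by (rule imageE)
    then have "xs \<in> cell_lists (n + 1)"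
      by (simp add: support_lists_def)
    then show "M \<in> S n P"
      using supp standard_puzzle_of xs unfolding S_def by simp
  qed
qed

lemma s_eq: "s n P = card (support_lists P (n + 1))"
  unfolding s_def S_eq
  by (rule card_image[OF inj_on_subset[OF inj_on_puzzle_of support_lists_subset]])

text \<open>\<open>0 < m\<close> makes \<open>m - 1\<close> a genuine predecessor: for
  \<open>m = 0\<close>, \<open>P_count\<close> speaks of a single column but
  \<open>support_lists\<close> of the empty list.\<close>

lemma P_count_eq:
  assumes "0 < m"
  shows "P_count x i j m = card {xs \<in> support_lists (simple_piece x) m.
    Suc (pos xs (1, m - 1)) = i \<and> Suc (pos xs (0, m - 1)) = i + j}" (is "_ = card ?X")
proof -
  obtain n where m: "m = n + 1"
    using assms by (cases m) auto
  have "{M \<in> S n (simple_piece x). M $$ (1, n) = i \<and> M $$ (0, n) = i + j} =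
    puzzle_of n ` {xs \<in> support_lists (simple_piece x) (n + 1).
      puzzle_of n xs $$ (1, n) = i \<and> puzzle_of n xs $$ (0, n) = i + j}"
    unfolding S_eq by blast
  then have "P_count x i j m = card (puzzle_of n ` ?X)"
    by (simp add: P_count_def m)
  also have "\<dots> = card ?X"
    unfolding m
    by (rule card_image[OF inj_on_subset[OF inj_on_puzzle_of]])
      (use support_lists_subset[of _ "n + 1"] in blast)
  finally show ?thesis .
qed

section \<open>Column directions of the pieces\<close>

lemma simple_piece_subset:
  assumes "x \<in> {1..20}"
  shows "simple_piece x \<subseteq> A_piece ` {1..6}"
proof -
  have "x - 1 < 20"
    using assms by auto
  then show ?thesis
    unfolding simple_piece_def
    by (auto simp: less_Suc_eq numeral_eq_Suc)
qed

lemma A_piece_columns: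
  assumes "M \<in> A_piece ` {1..6}" "t < 2"
  shows "M $$ (1, t) < M $$ (0, t)" "M \<in> carrier_mat 2 2"
proof -
  obtain i where M: "M = A_piece i" and i: "i \<in> {1..6}"
    using assms(1) by blast
  show "M $$ (1, t) < M $$ (0, t)" "M \<in> carrier_mat 2 2"
    using i assms(2) unfolding M one_to_six less_two_cases
    by (auto simp: A_piece_def mat_of_rows_list_def)
qed

lemma B_piece_columns:
  assumes "y \<in> {1..6}"
  shows "B_piece y $$ (1, 0) < B_piece y $$ (0, 0)" "B_piece y $$ (0, 1) < B_piece y $$ (1, 1)"
  using assms unfolding one_to_six by (auto simp: B_piece_def mat_of_rows_list_def)

text \<open>Prescribing the directions of both columns leaves six of the 24 standard pieces, and
  each pattern of \<open>B_order\<close> completes these two comparisons to a linear order of the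
  four entries.\<close>

lemma standard_piece_eq_B_piece_iff:
  assumes M: "standard_puzzle 1 M" "M $$ (1, 0) < M $$ (0, 0)" "M $$ (0, 1) < M $$ (1, 1)"
    and y: "y \<in> {1..6}"
  shows "M = B_piece y \<longleftrightarrow> B_order y (\<lambda>rc. M $$ rc) (1, 0) (0, 0) (0, 1) (1, 1)"
proof
  show "B_order y (\<lambda>rc. M $$ rc) (1, 0) (0, 0) (0, 1) (1, 1)" if "M = B_piece y"
    using y unfolding that one_to_six
    by (auto simp: B_order_def B_piece_def mat_of_rows_list_def)
next
  assume ord: "B_order y (\<lambda>rc. M $$ rc) (1, 0) (0, 0) (0, 1) (1, 1)"
  have c: "M \<in> carrier_mat 2 2"
    using M(1) by (simp add: standard_puzzle_def numeral_2_eq_2)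
  have "M $$ (r, t) \<in> {1..4}" if "r < 2" "t < 2" for r t
    using bij_betw_apply[of "\<lambda>rc. M $$ rc" "{..<2} \<times> {..<2}" "{1..4}" "(r, t)"] M(1) that
    by (simp add: standard_puzzle_def numeral_eq_Suc)
  then have rng: "1 \<le> M $$ (0, 0)" "M $$ (0, 0) \<le> 4" "1 \<le> M $$ (0, 1)" "M $$ (0, 1) \<le> 4"
    "1 \<le> M $$ (1, 0)" "M $$ (1, 0) \<le> 4" "1 \<le> M $$ (1, 1)" "M $$ (1, 1) \<le> 4"
    by auto
  \<comment> \<open>Each pattern yields a chain of four strictly increasing values between 1 and 4,
    which must be 1, 2, 3, 4.\<close>
  have entries: "M $$ (0, 0) = B_piece y $$ (0, 0) \<and> M $$ (0, 1) = B_piece y $$ (0, 1) \<and>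
      M $$ (1, 0) = B_piece y $$ (1, 0) \<and> M $$ (1, 1) = B_piece y $$ (1, 1)"
    using y ord M(2,3) rng unfolding one_to_six
    by (elim disjE) (simp_all add: B_order_def B_piece_def mat_of_rows_list_def)
  have "B_piece y \<in> carrier_mat 2 2"
    using y unfolding one_to_six by (auto simp: B_piece_def mat_of_rows_list_def)
  then show "M = B_piece y"
    using c entries by (intro eq_matI) (auto simp: less_two_cases)
qed

subsection \<open>Half turns\<close>

lemma set_cell_lists: "xs \<in> cell_lists m \<Longrightarrow> set xs = {..<2} \<times> {0..<m}"
  by (simp add: cell_lists_def atLeast0LessThan)

lemma set_cell_lists_subset:
  assumes "xs \<in> cell_lists m" "m \<le> n + 1"
  shows "set xs \<subseteq> {..<2} \<times> {..n}"
  unfolding set_cell_lists[OF assms(1)] using assms(2) by auto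

text \<open>The list is not reversed: turning moves the cells but keeps the entries.\<close>

definition half_turn :: "nat \<Rightarrow> (nat \<times> nat) list \<Rightarrow> (nat \<times> nat) list" where
  "half_turn n xs = map (\<lambda>(r, t). (1 - r, n - t)) xs"

lemma inj_on_half_turn: "inj_on (\<lambda>(r, t). (1 - r, n - t)) ({..<2::nat} \<times> {..n::nat})"
  by (rule inj_onI) auto

lemma half_turn_half_turn:
  assumes "set xs \<subseteq> {..<2} \<times> {..n}"
  shows "half_turn n (half_turn n xs) = xs"
  unfolding half_turn_def map_map by (rule map_idI) (use assms in auto)

lemma set_half_turn:
  assumes "set xs = {..<2} \<times> {a..<b}" "b \<le> n + 1"
  shows "set (half_turn n xs) = {..<2} \<times> {n + 1 - b..<n + 1 - a}"
proof (intro equalityI subsetI)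
  fix rc assume "rc \<in> set (half_turn n xs)"
  then obtain x where x: "x \<in> {..<2} \<times> {a..<b}" "rc = (1 - fst x, n - snd x)"
    unfolding half_turn_def assms(1)[symmetric] by (auto simp: case_prod_beta)
  then have "a \<le> snd x" "snd x < b"
    by (simp_all add: mem_Times_iff)
  then have "n + 1 - b \<le> n - snd x" "n - snd x < n + 1 - a"
    using assms(2) by linarith+
  then show "rc \<in> {..<2} \<times> {n + 1 - b..<n + 1 - a}"
    using x(2) by simp
next
  fix rc :: "nat \<times> nat"
  assume "rc \<in> {..<2} \<times> {n + 1 - b..<n + 1 - a}"
  then obtain r t where rc: "rc = (r, t)" "r < 2" "n + 1 - b \<le> t" "t < n + 1 - a"
    by auto
  then have "a \<le> n - t" "n - t < b"
    using assms(2) by linarith+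
  then have "(1 - r, n - t) \<in> set xs"
    using assms(1) by simp
  moreover have "(\<lambda>(r, t). (1 - r, n - t)) (1 - r, n - t) = rc"
    using rc by auto
  ultimately show "rc \<in> set (half_turn n xs)"
    unfolding half_turn_def set_map by (metis imageI)
qed

lemma distinct_half_turn:
  assumes "distinct xs" "set xs \<subseteq> {..<2} \<times> {..n}"
  shows "distinct (half_turn n xs)"
  unfolding half_turn_def distinct_map using assms inj_on_subset[OF inj_on_half_turn] by blast

lemma pos_half_turn:
  assumes "set xs \<subseteq> {..<2} \<times> {..n}" "r < 2" "t \<le> n"
  shows "pos (half_turn n xs) (1 - r, n - t) = pos xs (r, t)"
  using pos_map[OF inj_on_half_turn assms(1), of "(r, t)"] assms(2,3) by (simp add: half_turn_def)

text \<open>Column \<open>t\<close> moves to \<open>n - t\<close>, so the columns \<open>c\<close>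
  and \<open>Suc c\<close> of the turned list come from \<open>n - c\<close> and
  \<open>n - 1 - c\<close>: each piece is turned, and their order is reversed.\<close>

lemma column_pair_half_turn:
  assumes "set xs \<subseteq> {..<2} \<times> {..n}" "c < n"
  shows "column_pair c (half_turn n xs) = half_turn 1 (column_pair (n - 1 - c) xs)"
proof -
  have "filter ((\<lambda>rc. snd rc \<in> {c, Suc c}) \<circ> (\<lambda>(r, t). (1 - r, n - t))) xs =
    filter (\<lambda>rc. snd rc \<in> {n - 1 - c, Suc (n - 1 - c)}) xs"
    by (rule filter_cong) (use assms in auto)
  then show ?thesis
    unfolding column_pair_def half_turn_def filter_map map_map
    by (auto intro!: map_cong simp: assms(2)) (use assms in auto)
qed

text \<open>A piece on one side of the transition can be read off from the part on that
  side.\<close>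

lemma column_pair_filter:
  assumes "\<And>rc. snd rc \<in> {c, Suc c} \<Longrightarrow> A rc"
  shows "column_pair c (filter A xs) = column_pair c xs"
proof -
  have "filter (\<lambda>rc. A rc \<and> snd rc \<in> {c, Suc c}) xs = filter (\<lambda>rc. snd rc \<in> {c, Suc c}) xs"
    by (rule filter_cong) (use assms in auto)
  then show ?thesis
    unfolding column_pair_def filter_filter by simp
qed

section \<open>The map \<open>F1 \<circ> F2\<close> on pieces\<close>

lemma F1_F2_index:
  "r < 2 \<Longrightarrow> t < 2 \<Longrightarrow> (F1 \<circ> F2) M $$ (r, t) = M $$ (1 - r, 1 - t)"
  by (simp add: F1_def F2_def)

lemma F1_F2_carrier: "(F1 \<circ> F2) M \<in> carrier_mat 2 2"
  by (simp add: F1_def)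

lemma F1_F2_F1_F2:
  assumes "M \<in> carrier_mat 2 2"
  shows "(F1 \<circ> F2) ((F1 \<circ> F2) M) = M"
proof (rule eq_matI)
  fix r t assume "r < dim_row M" "t < dim_col M"
  then have "r < 2" "t < 2" "1 - r < 2" "1 - t < 2" "1 - (1 - r) = r" "1 - (1 - t) = t"
    using assms by auto
  then show "(F1 \<circ> F2) ((F1 \<circ> F2) M) $$ (r, t) = M $$ (r, t)"
    by (simp only: F1_F2_index)
qed (use assms F1_F2_carrier in auto)

lemma F1_F2_in_image_iff:
  assumes "M \<in> carrier_mat 2 2" "H \<subseteq> carrier_mat 2 2"
  shows "(F1 \<circ> F2) M \<in> (F1 \<circ> F2) ` H \<longleftrightarrow> M \<in> H"
proof
  assume "(F1 \<circ> F2) M \<in> (F1 \<circ> F2) ` H"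
  then obtain N where N: "(F1 \<circ> F2) M = (F1 \<circ> F2) N" "N \<in> H"
    by (rule imageE)
  then have "M = N"
    using F1_F2_F1_F2[OF assms(1)] F1_F2_F1_F2[of N] assms(2) by (metis subsetD)
  then show "M \<in> H"
    using N(2) by simp
qed (rule imageI)

text \<open>Exchanging both rows and columns is the rotation by 180 degrees, which moves the cells
  and keeps the entries.\<close>

lemma puzzle_of_half_turn:
  assumes "xs \<in> cell_lists 2"
  shows "puzzle_of 1 (half_turn 1 xs) = (F1 \<circ> F2) (puzzle_of 1 xs)"
proof (rule eq_matI)
  have xs: "set xs \<subseteq> {..<2} \<times> {..1}"
    by (rule set_cell_lists_subset[OF assms]) simp
  fix r t assume "r < dim_row ((F1 \<circ> F2) (puzzle_of 1 xs))" "t < dim_col ((F1 \<circ> F2) (puzzle_of 1 xs))"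
  then have rt: "r < 2" "t < 2"
    by (simp_all add: F1_def)
  then have *: "1 - r < 2" "1 - t \<le> 1" "1 - (1 - r) = r" "1 - (1 - t) = t"
    by auto
  then have "pos (half_turn 1 xs) (r, t) = pos xs (1 - r, 1 - t)"
    using pos_half_turn[OF xs *(1,2)] by simp
  then show "puzzle_of 1 (half_turn 1 xs) $$ (r, t) = (F1 \<circ> F2) (puzzle_of 1 xs) $$ (r, t)"
    using rt by (simp add: F1_F2_index del: o_apply)
qed (simp_all add: F1_def puzzle_of_def)

lemma piece_half_turn:
  assumes "set xs \<subseteq> {..<2} \<times> {..n}" "c < n" "column_pair (n - 1 - c) xs \<in> cell_lists 2"
    and "H \<subseteq> carrier_mat 2 2"
  shows "puzzle_of 1 (column_pair c (half_turn n xs)) \<in> (F1 \<circ> F2) ` H \<longleftrightarrow>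
    puzzle_of 1 (column_pair (n - 1 - c) xs) \<in> H"
  unfolding column_pair_half_turn[OF assms(1,2)] puzzle_of_half_turn[OF assms(3)]
proof (rule F1_F2_in_image_iff[OF _ assms(4)])
  show "puzzle_of 1 (column_pair (n - 1 - c) xs) \<in> carrier_mat 2 2"
    using puzzle_of_carrier[of 1] by (simp add: numeral_2_eq_2)
qed

subsection \<open>Position of the transition\<close>

definition up_column :: "(nat \<times> nat) list \<Rightarrow> nat \<Rightarrow> bool" where
  "up_column xs c \<longleftrightarrow> pos xs (1, c) < pos xs (0, c)"

lemma down_column:
  assumes "xs \<in> cell_lists m" "c < m"
  shows "\<not> up_column xs c \<longleftrightarrow> pos xs (0, c) < pos xs (1, c)"
proof -
  have "(0, c) \<in> set xs" "(1, c) \<in> set xs"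
    using assms(2) unfolding set_cell_lists[OF assms(1)] by simp_all
  then have "pos xs (0, c) \<noteq> pos xs (1, c)"
    using pos_inj[of "(0, c)" xs "(1, c)"] by auto
  then show ?thesis
    by (auto simp: up_column_def)
qed

lemma up_column_column_pair:
  assumes "xs \<in> cell_lists m" "Suc c < m" "t < 2"
  shows "puzzle_of 1 (column_pair c xs) $$ (1, t) < puzzle_of 1 (column_pair c xs) $$ (0, t) \<longleftrightarrow>
    up_column xs (c + t)"
  using assms pos_column_pair_less[OF assms(1,2), of 1 0 t t] by (simp add: up_column_def)

text \<open>\<open>m\<close> is the number of columns of the first kind, so the columns
  \<open>c\<close> and \<open>Suc c\<close> are both of this kind iff \<open>c + 1 < m\<close>, and
  the transition piece starts at column \<open>m - 1\<close>. For \<open>m = 0\<close> and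
  \<open>m = n + 1\<close> no transition piece is demanded.\<close>

definition split_lists ::
  "nat \<Rightarrow> nat mat set \<Rightarrow> nat mat \<Rightarrow> nat mat set \<Rightarrow> nat \<Rightarrow> (nat \<times> nat) list set" where
  "split_lists n G B H m = {zs \<in> cell_lists (n + 1). \<forall>c<n. puzzle_of 1 (column_pair c zs) \<in>
     (if c + 1 < m then G else if c + 1 = m then {B} else H)}"

lemma antimono_nat_threshold:
  fixes u :: "nat \<Rightarrow> bool"
  assumes "\<And>c. c < n \<Longrightarrow> u (Suc c) \<Longrightarrow> u c"
  shows "\<exists>m\<le>n + 1. \<forall>c\<le>n. u c \<longleftrightarrow> c < m"
proof -
  \<comment> \<open>The first index at which \<open>u\<close> fails; the disjunct
    \<open>n < m\<close> gives \<open>n + 1\<close> if there is none up to \<open>n\<close>.\<close>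
  define m where "m = (LEAST m. n < m \<or> \<not> u m)"
  have m: "n < m \<or> \<not> u m"
    unfolding m_def by (rule LeastI[of _ "n + 1"]) simp
  have below: "u c" if "c < m" for c
    using not_less_Least[of c "\<lambda>m. n < m \<or> \<not> u m"] that unfolding m_def by simp
  have "m \<le> n + 1"
    unfolding m_def by (rule Least_le) simp
  moreover have "\<not> u c" if "m \<le> c" "c \<le> n" for c
    using that by (induction rule: dec_induct) (use m assms in auto)
  ultimately show ?thesis
    using below by (meson not_less)
qed

text \<open>The pieces fix the directions of their columns, so \<open>zs\<close> determines
  \<open>m\<close>. For \<open>n \<ge> 1\<close> every column lies in some piece.\<close>

lemma up_column_split_lists:
  assumes G: "\<And>M t. M \<in> G \<Longrightarrow> t < 2 \<Longrightarrow> M $$ (1, t) < M $$ (0, t)"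
    and B: "B $$ (1, 0) < B $$ (0, 0)" "B $$ (0, 1) < B $$ (1, 1)"
    and H: "\<And>M t. M \<in> H \<Longrightarrow> t < 2 \<Longrightarrow> M $$ (0, t) < M $$ (1, t)"
    and zs: "zs \<in> split_lists n G B H m" and n: "n \<ge> 1" "m \<le> n + 1" "c \<le> n"
  shows "up_column zs c \<longleftrightarrow> c < m"
proof -
  have z: "zs \<in> cell_lists (n + 1)"
    using zs by (simp add: split_lists_def)
  \<comment> \<open>\<open>d\<close> is a piece containing column \<open>c\<close>: as its left
    column (\<open>t = 0\<close>), or for \<open>c = n\<close> as its right one
    (\<open>t = 1\<close>).\<close>
  define d where "d = (if c < n then c else n - 1)"
  define t where "t = c - d"
  have d: "d < n" "t < 2" "c = d + t" "t = 0 \<or> t = 1"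
    using n unfolding d_def t_def by auto
  let ?M = "puzzle_of 1 (column_pair d zs)"
  have M: "?M \<in> (if d + 1 < m then G else if d + 1 = m then {B} else H)"
    using zs d(1) unfolding split_lists_def by blast
  have up: "?M $$ (1, t) < ?M $$ (0, t) \<longleftrightarrow> up_column zs c"
    using up_column_column_pair[OF z, of d t] d by simp
  consider "d + 1 < m" | "d + 1 = m" | "m < d + 1"
    by linarith
  then show ?thesis
  proof cases
    case 1
    then have "c < m"
      using d by auto
    then show ?thesis
      using G[of ?M t] M 1 d(2) up by simp
  next
    case 2
    then have "?M = B"
      using M by simp
    then show ?thesis
      using B up d(3,4) 2 by auto
  next
    case 3
    then have "?M $$ (0, t) < ?M $$ (1, t)"
      using H[of ?M t] M d(2) by simp
    then show ?thesis
      using up 3 d(3) by auto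
  qed
qed

text \<open>No allowed piece leads from a column of the second kind to one of the first, so the
  columns of the first kind form an initial segment, of length \<open>m\<close>.\<close>

lemma support_lists_eq_UN_split_lists:
  assumes G: "\<And>M t. M \<in> G \<Longrightarrow> t < 2 \<Longrightarrow> M $$ (1, t) < M $$ (0, t)"
    and B: "B $$ (1, 0) < B $$ (0, 0)" "B $$ (0, 1) < B $$ (1, 1)"
    and H: "\<And>M t. M \<in> H \<Longrightarrow> t < 2 \<Longrightarrow> M $$ (0, t) < M $$ (1, t)"
  shows "support_lists (G \<union> {B} \<union> H) (n + 1) = (\<Union>m\<in>{..n + 1}. split_lists n G B H m)"
proof (intro equalityI subsetI)
  fix zs assume "zs \<in> (\<Union>m\<in>{..n + 1}. split_lists n G B H m)"
  then obtain m where m: "zs \<in> split_lists n G B H m"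
    by blast
  have "puzzle_of 1 (column_pair c zs) \<in> G \<union> {B} \<union> H" if "c < n" for c
  proof -
    have "puzzle_of 1 (column_pair c zs) \<in> (if c + 1 < m then G else if c + 1 = m then {B} else H)"
      using m that unfolding split_lists_def by blast
    then show ?thesis
      by (auto split: if_splits)
  qed
  then show "zs \<in> support_lists (G \<union> {B} \<union> H) (n + 1)"
    using m unfolding support_lists_def split_lists_def by simp
next
  fix zs assume "zs \<in> support_lists (G \<union> {B} \<union> H) (n + 1)"
  then have z: "zs \<in> cell_lists (n + 1)"
    and M: "\<And>c. c < n \<Longrightarrow> puzzle_of 1 (column_pair c zs) \<in> G \<union> {B} \<union> H"
    by (simp_all add: support_lists_def)
  let ?M = "\<lambda>c. puzzle_of 1 (column_pair c zs)"
  have up: "?M c $$ (1, 0) < ?M c $$ (0, 0) \<longleftrightarrow> up_column zs c"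
    "?M c $$ (1, 1) < ?M c $$ (0, 1) \<longleftrightarrow> up_column zs (Suc c)" if "c < n" for c
    using up_column_column_pair[OF z, of c 0] up_column_column_pair[OF z, of c 1] that by simp_all
  have up_G: "up_column zs c" "up_column zs (Suc c)" if "c < n" "?M c \<in> G" for c
    using G[OF that(2), of 0] G[OF that(2), of 1] up[OF that(1)] by simp_all
  have up_B: "up_column zs c" "\<not> up_column zs (Suc c)" if "c < n" "?M c = B" for c
    using B up[OF that(1)] unfolding that(2) by simp_all
  have up_H: "\<not> up_column zs c" "\<not> up_column zs (Suc c)" if "c < n" "?M c \<in> H" for c
    using H[OF that(2), of 0] H[OF that(2), of 1] up[OF that(1)] by simp_all
  have cases: "?M c \<in> G \<or> ?M c = B \<or> ?M c \<in> H" if "c < n" for c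
    using M[OF that] by blast
  have anti: "up_column zs c" if "c < n" "up_column zs (Suc c)" for c
    using cases[OF that(1)] up_G[OF that(1)] up_B[OF that(1)] up_H[OF that(1)] that(2) by blast
  obtain m where m: "m \<le> n + 1" "\<And>c. c \<le> n \<Longrightarrow> up_column zs c \<longleftrightarrow> c < m"
    using antimono_nat_threshold[of n "up_column zs", OF anti] by blast
  \<comment> \<open>The directions of the two columns tell the three sets apart: up-up for
    \<open>G\<close>, up-down for \<open>B\<close>, down-down for \<open>H\<close>.\<close>
  have "?M c \<in> (if c + 1 < m then G else if c + 1 = m then {B} else H)" if c: "c < n" for c
  proof -
    have u: "up_column zs c \<longleftrightarrow> c < m" "up_column zs (Suc c) \<longleftrightarrow> Suc c < m"
      using m(2)[of c] m(2)[of "Suc c"] c by simp_all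
    consider "c + 1 < m" | "c + 1 = m" | "m < c + 1"
      by linarith
    then show ?thesis
    proof cases
      case 1
      then show ?thesis
        using cases[OF c] up_B(2)[OF c] up_H(2)[OF c] u by auto
    next
      case 2
      then show ?thesis
        using cases[OF c] up_G(2)[OF c] up_H(1)[OF c] u by auto
    next
      case 3
      then show ?thesis
        using cases[OF c] up_G(1)[OF c] up_B(1)[OF c] u by auto
    qed
  qed
  then have "zs \<in> split_lists n G B H m"
    using z by (simp add: split_lists_def)
  then show "zs \<in> (\<Union>m\<in>{..n + 1}. split_lists n G B H m)"
    using m(1) by blast
qed

lemma split_lists_last: "split_lists n G B H (n + 1) = support_lists G (n + 1)"
  by (auto simp: split_lists_def support_lists_def)

text \<open>Without columns of the first kind the whole puzzle is the half turn of one supported by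
  \<open>H\<close>, and the half turn is an involution on cell lists.\<close>

lemma split_lists_first:
  assumes "H \<subseteq> carrier_mat 2 2"
  shows "split_lists n G B ((F1 \<circ> F2) ` H) 0 = half_turn n ` support_lists H (n + 1)"
proof -
  have range: "set xs = {..<2} \<times> {0..<n + 1}" "set xs \<subseteq> {..<2} \<times> {..n}" if "xs \<in> cell_lists (n + 1)" for xs
    using set_cell_lists[OF that] set_cell_lists_subset[OF that, of n] by simp_all
  have closed: "half_turn n xs \<in> cell_lists (n + 1)" if "xs \<in> cell_lists (n + 1)" for xs
    using set_half_turn[OF range(1)[OF that], of n] distinct_half_turn[OF _ range(2)[OF that]] that
    by (simp add: cell_lists_def atLeast0LessThan)
  have piece: "puzzle_of 1 (column_pair c (half_turn n xs)) \<in> (F1 \<circ> F2) ` H \<longleftrightarrow>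
      puzzle_of 1 (column_pair (n - 1 - c) xs) \<in> H" if "xs \<in> cell_lists (n + 1)" "c < n" for xs c
  proof -
    have "column_pair (n - 1 - c) xs \<in> cell_lists 2"
      using column_pair_in_cell_lists[OF that(1), of "n - 1 - c"] that(2) by simp
    then show ?thesis
      by (rule piece_half_turn[OF range(2)[OF that(1)] that(2) _ assms])
  qed
  have mem: "half_turn n xs \<in> split_lists n G B ((F1 \<circ> F2) ` H) 0 \<longleftrightarrow> xs \<in> support_lists H (n + 1)"
    if xs: "xs \<in> cell_lists (n + 1)" for xs
  proof -
    have "half_turn n xs \<in> split_lists n G B ((F1 \<circ> F2) ` H) 0 \<longleftrightarrow>
        (\<forall>c<n. puzzle_of 1 (column_pair (n - 1 - c) xs) \<in> H)"
      using piece[OF xs] closed[OF xs] by (simp add: split_lists_def del: o_apply)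
    \<comment> \<open>Turning reverses the order of the pieces; \<open>c\<close> to
      \<open>n - 1 - c\<close> permutes the indices below \<open>n\<close>.\<close>
    also have "\<dots> \<longleftrightarrow> (\<forall>c<n. puzzle_of 1 (column_pair c xs) \<in> H)"
      (is "?l \<longleftrightarrow> ?r")
    proof
      assume l: ?l
      show ?r
      proof (intro allI impI)
        fix c assume "c < n"
        then have "n - 1 - c < n" "n - 1 - (n - 1 - c) = c"
          by auto
        then show "puzzle_of 1 (column_pair c xs) \<in> H"
          using l by metis
      qed
    next
      assume ?r
      then show ?l
        by simp
    qed
    finally show ?thesis
      using xs by (simp add: support_lists_def)
  qed
  show ?thesis
  proof (intro equalityI subsetI)
    fix zs assume zs: "zs \<in> split_lists n G B ((F1 \<circ> F2) ` H) 0"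
    then have z: "zs \<in> cell_lists (n + 1)"
      by (simp add: split_lists_def)
    have "zs = half_turn n (half_turn n zs)"
      by (rule half_turn_half_turn[OF range(2)[OF z], symmetric])
    then show "zs \<in> half_turn n ` support_lists H (n + 1)"
      using mem[OF closed[OF z]] zs by (metis imageI)
  next
    fix zs assume "zs \<in> half_turn n ` support_lists H (n + 1)"
    then obtain xs where xs: "zs = half_turn n xs" "xs \<in> support_lists H (n + 1)"
      by (rule imageE)
    then show "zs \<in> split_lists n G B ((F1 \<circ> F2) ` H) 0"
      using mem[of xs] support_lists_subset by blast
  qed
qed

lemma card_split_lists_first:
  assumes "H \<subseteq> carrier_mat 2 2"
  shows "card (split_lists n G B ((F1 \<circ> F2) ` H) 0) = card (support_lists H (n + 1))"
  unfolding split_lists_first[OF assms]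
proof (rule card_image, rule inj_onI)
  fix xs ys assume *: "xs \<in> support_lists H (n + 1)" "ys \<in> support_lists H (n + 1)"
    "half_turn n xs = half_turn n ys"
  then have "set xs \<subseteq> {..<2} \<times> {..n}" "set ys \<subseteq> {..<2} \<times> {..n}"
    using set_cell_lists_subset[of _ "n + 1" n] support_lists_subset by (metis le_refl subsetD)+
  then show "xs = ys"
    using *(3) by (metis half_turn_half_turn)
qed

subsection \<open>Counting by the position of the transition\<close>

text \<open>The condition on the last column only matters for \<open>m = 1\<close>, where the support condition is
  void.\<close>

definition up_lists :: "nat mat set \<Rightarrow> nat \<Rightarrow> (nat \<times> nat) list set" where
  "up_lists G m = {xs \<in> support_lists G m. up_column xs (m - 1)}"

lemma finite_up_lists [simp]: "finite (up_lists G m)"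
  by (simp add: up_lists_def)

lemma up_listsD:
  assumes "xs \<in> up_lists G m"
  shows "xs \<in> cell_lists m" "up_column xs (m - 1)"
    "\<And>c. Suc c < m \<Longrightarrow> puzzle_of 1 (column_pair c xs) \<in> G"
  using assms by (simp_all add: up_lists_def support_lists_def)

text \<open>The parts occupy different columns, so a shuffle determines both lists it was made
  from.\<close>

lemma filter_columns_shuffles:
  fixes xs ys :: "(nat \<times> nat) list"
  assumes "set xs = {..<2} \<times> {0..<m}" "set ys = {..<2} \<times> {m..<n + 1}" "zs \<in> shuffles xs ys"
  shows "filter (\<lambda>rc. snd rc < m) zs = xs" "filter (\<lambda>rc. \<not> snd rc < m) zs = ys"
proof -
  have disj: "set xs \<inter> set ys = {}"
    unfolding assms by auto
  have eq: "rc \<in> set xs \<longleftrightarrow> snd rc < m" if "rc \<in> set zs" for rc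
    using that unfolding set_shuffles[OF assms(3)] assms(1,2) by auto
  have "filter (\<lambda>rc. snd rc < m) zs = filter (\<lambda>rc. rc \<in> set xs) zs"
    "filter (\<lambda>rc. \<not> snd rc < m) zs = filter (\<lambda>rc. rc \<notin> set xs) zs"
    by (rule filter_cong; simp add: eq)+
  then show "filter (\<lambda>rc. snd rc < m) zs = xs" "filter (\<lambda>rc. \<not> snd rc < m) zs = ys"
    using filter_shuffles_disjoint1[OF disj assms(3)] by simp_all
qed

lemma B_order_column_pair:
  assumes "zs \<in> cell_lists (n + 1)" "1 \<le> m" "m \<le> n"
    and "pos zs (1, m - 1) < pos zs (0, m - 1)" "pos zs (0, m) < pos zs (1, m)"
    and "y \<in> {1..6}"
  shows "puzzle_of 1 (column_pair (m - 1) zs) = B_piece y \<longleftrightarrow>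
    B_order y (pos zs) (1, m - 1) (0, m - 1) (0, m) (1, m)"
proof -
  let ?M = "puzzle_of 1 (column_pair (m - 1) zs)"
  have m: "Suc (m - 1) < n + 1" "m - 1 + 0 = m - 1" "m - 1 + 1 = m"
    using assms by auto
  have less: "?M $$ (r, t) < ?M $$ (r', t') \<longleftrightarrow> pos zs (r, m - 1 + t) < pos zs (r', m - 1 + t')"
    if "r < 2" "r' < 2" "t < 2" "t' < 2" for r r' t t'
    using pos_column_pair_less[OF assms(1) m(1) that] that by simp
  have "column_pair (m - 1) zs \<in> cell_lists (1 + 1)"
    using column_pair_in_cell_lists[OF assms(1) m(1)] by (simp add: numeral_2_eq_2)
  then have "standard_puzzle 1 ?M"
    by (rule standard_puzzle_of)
  moreover have "?M $$ (1, 0) < ?M $$ (0, 0)" "?M $$ (0, 1) < ?M $$ (1, 1)"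
    using assms(4,5) less[of 1 0 0 0] less[of 0 1 1 1] unfolding m(2,3) by simp_all
  ultimately have "?M = B_piece y \<longleftrightarrow> B_order y (\<lambda>rc. ?M $$ rc) (1, 0) (0, 0) (0, 1) (1, 1)"
    by (rule standard_piece_eq_B_piece_iff[OF _ _ _ assms(6)])
  also have "\<dots> \<longleftrightarrow> B_order y (pos zs) (1, m - 1) (0, m - 1) (0, m) (1, m)"
    using less[of 1 0 0 1] less[of 0 1 1 0] less[of 1 1 0 1] less[of 1 1 1 0]
      less[of 0 0 0 1] less[of 0 0 1 0] less[of 0 1 0 1] less[of 1 0 1 0]
    unfolding m(2,3) by (intro B_order_cong) simp_all
  finally show ?thesis .
qed

text \<open>Every piece except the one across the columns \<open>m - 1\<close> and \<open>m\<close>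
  lies within one part, so the parts are chosen independently; the exceptional piece becomes an
  order condition on the shuffle.\<close>

lemma split_lists_middle:
  assumes G: "\<And>M t. M \<in> G \<Longrightarrow> t < 2 \<Longrightarrow> M $$ (1, t) < M $$ (0, t)"
    and H: "\<And>M t. M \<in> (F1 \<circ> F2) ` H \<Longrightarrow> t < 2 \<Longrightarrow> M $$ (0, t) < M $$ (1, t)"
      "H \<subseteq> carrier_mat 2 2"
    and y: "y \<in> {1..6}" and m: "1 \<le> m" "m \<le> n"
  shows "split_lists n G (B_piece y) ((F1 \<circ> F2) ` H) m =
    (\<Union>(xs, ys) \<in> up_lists G m \<times> up_lists H (n + 1 - m).
      {zs \<in> shuffles xs (half_turn n ys).
        B_order y (pos zs) (1, m - 1) (0, m - 1) (0, m) (1, m)})" (is "?X = ?Y")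
proof (intro equalityI subsetI)
  fix zs assume zs: "zs \<in> ?X"
  then have z: "zs \<in> cell_lists (n + 1)"
    by (simp add: split_lists_def)
  have piece: "puzzle_of 1 (column_pair c zs) \<in>
      (if c + 1 < m then G else if c + 1 = m then {B_piece y} else (F1 \<circ> F2) ` H)" if "c < n" for c
    using zs that unfolding split_lists_def by blast
  have up: "up_column zs c \<longleftrightarrow> c < m" if "c \<le> n" for c
    by (rule up_column_split_lists[OF G B_piece_columns[OF y] H(1) zs])
      (use m that in \<open>simp_all del: o_apply\<close>)
  define xs where "xs = filter (\<lambda>rc. snd rc < m) zs"
  define us where "us = filter (\<lambda>rc. \<not> snd rc < m) zs"
  have set_zs: "set zs = {..<2} \<times> {0..<n + 1}" and "distinct zs"
    using set_cell_lists[OF z] z by (simp_all add: cell_lists_def)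
  have set_xs: "set xs = {..<2} \<times> {0..<m}"
    unfolding xs_def set_filter set_zs using m by auto
  have set_us: "set us = {..<2} \<times> {m..<n + 1}"
    unfolding us_def set_filter set_zs by auto
  have us_sub: "set us \<subseteq> {..<2} \<times> {..n}"
    unfolding set_us by auto
  have dist: "distinct xs" "distinct us"
    using \<open>distinct zs\<close> by (simp_all add: xs_def us_def)
  \<comment> \<open>Turning the columns \<open>m\<close> to \<open>n\<close> makes column
    \<open>m\<close> the last column \<open>n - m\<close> of \<open>ys\<close>, the one to which
    \<open>P_count\<close> refers.\<close>
  define ys where "ys = half_turn n us"
  have us: "us = half_turn n ys"
    unfolding ys_def by (rule half_turn_half_turn[OF us_sub, symmetric])
  have set_ys: "set ys = {..<2} \<times> {0..<n + 1 - m}"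
    unfolding ys_def using set_half_turn[OF set_us, of n] by simp
  have xs_cells: "xs \<in> cell_lists m"
    using dist(1) set_xs by (simp add: cell_lists_def atLeast0LessThan)
  have ys_cells: "ys \<in> cell_lists (n + 1 - m)"
    using distinct_half_turn[OF dist(2) us_sub] set_ys
    by (simp add: cell_lists_def atLeast0LessThan ys_def)
  have "puzzle_of 1 (column_pair c xs) \<in> G" if "Suc c < m" for c
  proof -
    have "column_pair c xs = column_pair c zs"
      unfolding xs_def by (rule column_pair_filter) (use that in auto)
    then show ?thesis
      using piece[of c] that m by simp
  qed
  \<comment> \<open>For \<open>m = 1\<close> no piece of \<open>xs\<close> could force this; it is
    inherited from the column directions of \<open>zs\<close>.\<close>
  moreover have "up_column xs (m - 1)"
  proof -
    have "pos xs (1, m - 1) < pos xs (0, m - 1) \<longleftrightarrow> pos zs (1, m - 1) < pos zs (0, m - 1)"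
      unfolding xs_def by (rule pos_filter_less) (use m in \<open>simp_all add: set_zs\<close>)
    then show ?thesis
      using up[of "m - 1"] m by (simp add: up_column_def)
  qed
  ultimately have xs: "xs \<in> up_lists G m"
    using xs_cells by (simp add: up_lists_def support_lists_def)
  have "puzzle_of 1 (column_pair c ys) \<in> H" if c: "Suc c < n + 1 - m" for c
  proof -
    \<comment> \<open>The piece of \<open>zs\<close> whose half turn is the piece of
      \<open>ys\<close> at \<open>c\<close>; it lies to the right of the transition.\<close>
    let ?c = "n - 1 - c"
    have c': "?c < n" "n - 1 - ?c = c" "m \<le> ?c"
      using c by auto
    have "column_pair ?c us = column_pair ?c zs"
      unfolding us_def by (rule column_pair_filter) (use c' in auto)
    then have "puzzle_of 1 (column_pair ?c (half_turn n ys)) \<in> (F1 \<circ> F2) ` H"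
      using piece[OF c'(1)] c'(3) us by (simp del: o_apply)
    moreover have "set ys \<subseteq> {..<2} \<times> {..n}"
      unfolding set_ys by auto
    moreover have "column_pair c ys \<in> cell_lists 2"
      by (rule column_pair_in_cell_lists[OF ys_cells c])
    ultimately show ?thesis
      using piece_half_turn[of ys n ?c H] c' H(2) by (simp del: o_apply)
  qed
  moreover have down: "pos zs (0, m) < pos zs (1, m)"
    using up[of m] down_column[OF z, of m] m by simp
  then have "up_column ys (n + 1 - m - 1)"
  proof -
    have "pos ys (1 - r, n - m) = pos us (r, m)" if "r < 2" for r
      unfolding ys_def using pos_half_turn[OF us_sub that m(2)] .
    from this[of 0] this[of 1] have "pos ys (1, n - m) = pos us (0, m)" "pos ys (0, n - m) = pos us (1, m)"
      by simp_all
    moreover have "pos us (0, m) < pos us (1, m) \<longleftrightarrow> pos zs (0, m) < pos zs (1, m)"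
      unfolding us_def by (rule pos_filter_less) (use m in \<open>simp_all add: set_zs\<close>)
    ultimately show ?thesis
      using down by (simp add: up_column_def)
  qed
  ultimately have ys: "ys \<in> up_lists H (n + 1 - m)"
    using ys_cells by (simp add: up_lists_def support_lists_def)
  have "zs \<in> shuffles xs (half_turn n ys)"
    unfolding us[symmetric] unfolding xs_def us_def by (rule partition_in_shuffles)
  moreover have "B_order y (pos zs) (1, m - 1) (0, m - 1) (0, m) (1, m)"
  proof -
    have "puzzle_of 1 (column_pair (m - 1) zs) = B_piece y"
      using piece[of "m - 1"] m by simp
    moreover have "pos zs (1, m - 1) < pos zs (0, m - 1)"
      using up[of "m - 1"] m by (simp add: up_column_def)
    ultimately show ?thesis
      using B_order_column_pair[OF z m _ down y] by blast
  qed
  ultimately show "zs \<in> ?Y"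
    using xs ys by blast
next
  fix zs assume "zs \<in> ?Y"
  then obtain xs ys where xs: "xs \<in> up_lists G m" and ys: "ys \<in> up_lists H (n + 1 - m)"
    and zs: "zs \<in> shuffles xs (half_turn n ys)"
    and ord: "B_order y (pos zs) (1, m - 1) (0, m - 1) (0, m) (1, m)"
    by blast
  note set_xs = set_cell_lists[OF up_listsD(1)[OF xs]]
  note set_ys = set_cell_lists[OF up_listsD(1)[OF ys]]
  have ys_sub: "set ys \<subseteq> {..<2} \<times> {..n}"
    unfolding set_ys by auto
  let ?us = "half_turn n ys"
  have set_us: "set ?us = {..<2} \<times> {m..<n + 1}"
    using set_half_turn[OF set_ys, of n] m by simp
  have disj: "set xs \<inter> set ?us = {}"
    unfolding set_xs set_us by auto
  have "distinct zs"
    using up_listsD(1)[OF xs] up_listsD(1)[OF ys] distinct_half_turn[OF _ ys_sub]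
    by (intro distinct_disjoint_shuffles[OF _ _ disj zs]) (simp_all add: cell_lists_def)
  moreover have set_zs: "set zs = {..<2} \<times> {0..<n + 1}"
    unfolding set_shuffles[OF zs] set_xs set_us using m by auto
  ultimately have z: "zs \<in> cell_lists (n + 1)"
    by (simp add: cell_lists_def atLeast0LessThan)
  note filters = filter_columns_shuffles[OF set_xs set_us zs]
  have "puzzle_of 1 (column_pair c zs) \<in>
      (if c + 1 < m then G else if c + 1 = m then {B_piece y} else (F1 \<circ> F2) ` H)" if c: "c < n" for c
  proof -
    consider "c + 1 < m" | "c + 1 = m" | "m < c + 1"
      by linarith
    then show ?thesis
    proof cases
      case 1
      have "column_pair c (filter (\<lambda>rc. snd rc < m) zs) = column_pair c zs"
        by (rule column_pair_filter) (use 1 in auto)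
      then show ?thesis
        using up_listsD(3)[OF xs, of c] 1 by (simp add: filters)
    next
      case 2
      \<comment> \<open>The last columns of \<open>xs\<close> and \<open>ys\<close> supply the
        directions of the two columns, and \<open>ord\<close> the remaining comparisons.\<close>
      have "pos zs (1, m - 1) < pos zs (0, m - 1)"
      proof -
        have "pos (filter (\<lambda>rc. snd rc < m) zs) (1, m - 1) < pos (filter (\<lambda>rc. snd rc < m) zs) (0, m - 1)
          \<longleftrightarrow> pos zs (1, m - 1) < pos zs (0, m - 1)"
          by (rule pos_filter_less) (use m in \<open>simp_all add: set_zs\<close>)
        then show ?thesis
          using up_listsD(2)[OF xs] by (simp add: filters up_column_def)
      qed
      moreover have "pos zs (0, m) < pos zs (1, m)"
      proof -
        have "pos (filter (\<lambda>rc. \<not> snd rc < m) zs) (0, m) < pos (filter (\<lambda>rc. \<not> snd rc < m) zs) (1, m)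
          \<longleftrightarrow> pos zs (0, m) < pos zs (1, m)"
          by (rule pos_filter_less) (use m in \<open>simp_all add: set_zs\<close>)
        moreover have "pos ?us (0, m) = pos ys (1, n - m)" "pos ?us (1, m) = pos ys (0, n - m)"
          using pos_half_turn[OF ys_sub, of 1 "n - m"] pos_half_turn[OF ys_sub, of 0 "n - m"] m by simp_all
        ultimately show ?thesis
          using up_listsD(2)[OF ys] by (simp add: filters up_column_def)
      qed
      ultimately have "puzzle_of 1 (column_pair (m - 1) zs) = B_piece y"
        using B_order_column_pair[OF z m _ _ y] ord by blast
      moreover have "m - 1 = c"
        using 2 by simp
      ultimately show ?thesis
        using 2 by simp
    next
      case 3
      have "column_pair c (filter (\<lambda>rc. \<not> snd rc < m) zs) = column_pair c zs"
        by (rule column_pair_filter) (use 3 in auto)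
      then have eq: "column_pair c zs = column_pair c ?us"
        by (simp add: filters)
      have c': "Suc (n - 1 - c) < n + 1 - m"
        using 3 c by simp
      have "puzzle_of 1 (column_pair c ?us) \<in> (F1 \<circ> F2) ` H"
        using piece_half_turn[OF ys_sub c column_pair_in_cell_lists[OF up_listsD(1)[OF ys] c'] H(2)]
          up_listsD(3)[OF ys c'] by blast
      then show ?thesis
        using 3 eq by (simp del: o_apply)
    qed
  qed
  then show "zs \<in> ?X"
    using z by (simp add: split_lists_def del: o_apply)
qed

text \<open>By \<open>filter_columns_shuffles\<close> different pairs of parts have no shuffle in
  common, so the counts from \<open>card_shuffles_B_order\<close> add up.\<close>

lemma card_split_lists_middle:
  assumes G: "\<And>M t. M \<in> G \<Longrightarrow> t < 2 \<Longrightarrow> M $$ (1, t) < M $$ (0, t)"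
    and H: "\<And>M t. M \<in> (F1 \<circ> F2) ` H \<Longrightarrow> t < 2 \<Longrightarrow> M $$ (0, t) < M $$ (1, t)"
      "H \<subseteq> carrier_mat 2 2"
    and y: "y \<in> {1..6}" and m: "1 \<le> m" "m \<le> n" and p: "p = n + 1 - m"
  shows "card (split_lists n G (B_piece y) ((F1 \<circ> F2) ` H) m) =
    (\<Sum>xs \<in> up_lists G m. \<Sum>ys \<in> up_lists H p.
      T y (Suc (pos xs (1, m - 1))) (pos xs (0, m - 1) - pos xs (1, m - 1))
        (Suc (pos ys (1, p - 1))) (pos ys (0, p - 1) - pos ys (1, p - 1)) m p)"
proof -
  let ?Z = "\<lambda>(xs, ys). {zs \<in> shuffles xs (half_turn n ys).
        B_order y (pos zs) (1, m - 1) (0, m - 1) (0, m) (1, m)}"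
  let ?T = "\<lambda>xs ys. T y (Suc (pos xs (1, m - 1))) (pos xs (0, m - 1) - pos xs (1, m - 1))
        (Suc (pos ys (1, p - 1))) (pos ys (0, p - 1) - pos ys (1, p - 1)) m p"
  let ?I = "up_lists G m \<times> up_lists H p"
  have sets: "set xs = {..<2} \<times> {0..<m}" "set (half_turn n ys) = {..<2} \<times> {m..<n + 1}"
    "set ys \<subseteq> {..<2} \<times> {..n}" if "(xs, ys) \<in> ?I" for xs ys
  proof -
    note * = set_cell_lists[OF up_listsD(1)[of ys H p]]
    show "set xs = {..<2} \<times> {0..<m}"
      using set_cell_lists[OF up_listsD(1)[of xs G m]] that by simp
    show "set (half_turn n ys) = {..<2} \<times> {m..<n + 1}"
      using set_half_turn[OF *, of n] that m p by simp
    show "set ys \<subseteq> {..<2} \<times> {..n}"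
      using set_cell_lists_subset[OF up_listsD(1)[of ys H p], of n] that m p by simp
  qed
  have disjoint: "?Z i \<inter> ?Z j = {}" if "i \<in> ?I" "j \<in> ?I" "i \<noteq> j" for i j
  proof (rule ccontr)
    obtain xs ys xs' ys' where ij: "i = (xs, ys)" "j = (xs', ys')"
      by (cases i; cases j)
    assume "?Z i \<inter> ?Z j \<noteq> {}"
    then obtain zs where zs: "zs \<in> shuffles xs (half_turn n ys)" "zs \<in> shuffles xs' (half_turn n ys')"
      unfolding ij by auto
    note s = sets[OF that(1)[unfolded ij]] and s' = sets[OF that(2)[unfolded ij]]
    have "xs = xs'" "half_turn n ys = half_turn n ys'"
      using filter_columns_shuffles[OF s(1,2) zs(1)] filter_columns_shuffles[OF s'(1,2) zs(2)] by simp_all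
    moreover from this(2) have "ys = ys'"
      using half_turn_half_turn[OF s(3)] half_turn_half_turn[OF s'(3)] by metis
    ultimately show False
      using that(3) ij by simp
  qed
  have card_Z: "card (?Z i) = (case i of (xs, ys) \<Rightarrow> ?T xs ys)" if "i \<in> ?I" for i
  proof -
    obtain xs ys where i: "i = (xs, ys)" and xs: "xs \<in> up_lists G m" and ys: "ys \<in> up_lists H p"
      using \<open>i \<in> ?I\<close> by blast
    note s = sets[OF that[unfolded i]]
    let ?us = "half_turn n ys"
    \<comment> \<open>The half turn exchanges top and bottom: the top right cell of the transition
      piece is the bottom cell of the last column of \<open>ys\<close>. Hence \<open>k\<close> is
      the bottom rank there and \<open>k + l\<close> the top one.\<close>
    have pos: "pos ?us (0, m) = pos ys (1, p - 1)" "pos ?us (1, m) = pos ys (0, p - 1)"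
      using pos_half_turn[OF s(3), of 1 "n - m"] pos_half_turn[OF s(3), of 0 "n - m"] m p by simp_all
    have "distinct xs" "distinct ?us"
      using up_listsD(1)[OF xs] up_listsD(1)[OF ys] distinct_half_turn[OF _ s(3)]
      by (simp_all add: cell_lists_def)
    moreover have "set xs \<inter> set ?us = {}"
      unfolding s by auto
    ultimately have dist: "distinct (xs @ ?us)"
      by simp
    have len: "length xs = 2 * m" "length ?us = 2 * p"
      using length_cell_lists[OF up_listsD(1)[OF xs]] length_cell_lists[OF up_listsD(1)[OF ys]]
      by (simp_all add: half_turn_def)
    have mem: "(1, m - 1) \<in> set xs" "(0, m - 1) \<in> set xs" "(0, m) \<in> set ?us" "(1, m) \<in> set ?us"
      unfolding s using m by simp_all
    have less: "pos xs (1, m - 1) < pos xs (0, m - 1)" "pos ?us (0, m) < pos ?us (1, m)"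
      using up_listsD(2)[OF xs] up_listsD(2)[OF ys] unfolding pos by (simp_all add: up_column_def)
    show ?thesis
      using card_shuffles_B_order[OF dist len mem(1,2) less(1) mem(3,4) less(2) y]
      unfolding i pos by simp
  qed
  have "card (split_lists n G (B_piece y) ((F1 \<circ> F2) ` H) m) = card (\<Union>i\<in>?I. ?Z i)"
    using split_lists_middle[OF G H y m] p by (simp only:)
  also have "\<dots> = (\<Sum>i\<in>?I. card (?Z i))"
    by (rule card_UN_disjoint) (use disjoint in auto)
  also have "\<dots> = (\<Sum>(xs, ys)\<in>?I. ?T xs ys)"
    by (rule sum.cong[OF refl card_Z])
  also have "\<dots> = (\<Sum>xs \<in> up_lists G m. \<Sum>ys \<in> up_lists H p. ?T xs ys)"
    by (rule sum.cartesian_product[symmetric])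
  finally show ?thesis .
qed

section \<open>Summation over the last columns\<close>

definition last_columns :: "nat \<Rightarrow> (nat \<times> nat) set" where
  "last_columns m = {(i, j). 0 < i \<and> 0 < j \<and> i + j \<le> 2 * m}"

lemma finite_last_columns [simp]: "finite (last_columns m)"
  by (rule finite_subset[of _ "{..2 * m} \<times> {..2 * m}"]) (auto simp: last_columns_def)

text \<open>The summand only depends on the ranks in the last column, and the fibre over
  \<open>(i, j)\<close> has \<open>P_count x i j m\<close> elements.\<close>

lemma sum_up_lists:
  assumes "0 < m"
  shows "(\<Sum>xs \<in> up_lists (simple_piece x) m.
      g (Suc (pos xs (1, m - 1))) (pos xs (0, m - 1) - pos xs (1, m - 1))) =
    (\<Sum>(i, j) \<in> last_columns m. P_count x i j m * (g i j :: nat))"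
proof -
  let ?U = "up_lists (simple_piece x) m"
  let ?f = "\<lambda>xs. (Suc (pos xs (1, m - 1)), pos xs (0, m - 1) - pos xs (1, m - 1))"
  have range: "?f ` ?U \<subseteq> last_columns m"
  proof
    fix ij assume "ij \<in> ?f ` ?U"
    then obtain xs where xs: "xs \<in> ?U" "ij = ?f xs"
      by blast
    have "(0, m - 1) \<in> set xs"
      using assms unfolding set_cell_lists[OF up_listsD(1)[OF xs(1)]] by simp
    then have "pos xs (0, m - 1) < 2 * m"
      using pos_less_length length_cell_lists[OF up_listsD(1)[OF xs(1)]] by metis
    then show "ij \<in> last_columns m"
      using up_listsD(2)[OF xs(1)] xs(2) by (simp add: last_columns_def up_column_def)
  qed
  have "(\<Sum>xs \<in> ?U. case ?f xs of (i, j) \<Rightarrow> g i j) =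
      (\<Sum>ij \<in> last_columns m. \<Sum>xs | xs \<in> ?U \<and> ?f xs = ij. case ?f xs of (i, j) \<Rightarrow> g i j)"
    by (rule sum.group[symmetric]) (use range in simp_all)
  also have "\<dots> = (\<Sum>(i, j) \<in> last_columns m. P_count x i j m * g i j)"
  proof (rule sum.cong[OF refl])
    fix ij assume ij: "ij \<in> last_columns m"
    obtain i j where eq: "ij = (i, j)"
      by (cases ij)
    \<comment> \<open>For positive \<open>j\<close> the ranks \<open>i\<close> and
      \<open>i + j\<close> already force the last column upwards, so the fibre is the set counted by
      \<open>P_count_eq\<close>.\<close>
    have "0 < j"
      using ij by (simp add: eq last_columns_def)
    then have "{xs. xs \<in> ?U \<and> ?f xs = ij} = {xs \<in> support_lists (simple_piece x) m.
        Suc (pos xs (1, m - 1)) = i \<and> Suc (pos xs (0, m - 1)) = i + j}"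
      unfolding eq by (auto simp: up_lists_def up_column_def)
    then have "P_count x i j m = card {xs. xs \<in> ?U \<and> ?f xs = ij}"
      using P_count_eq[OF assms] by simp
    moreover have "(\<Sum>xs | xs \<in> ?U \<and> ?f xs = ij. case ?f xs of (i, j) \<Rightarrow> g i j) =
        (\<Sum>xs | xs \<in> ?U \<and> ?f xs = ij. g i j)"
      by (rule sum.cong) (simp_all add: eq)
    ultimately show "(\<Sum>xs | xs \<in> ?U \<and> ?f xs = ij. case ?f xs of (i, j) \<Rightarrow> g i j) =
        (case ij of (i, j) \<Rightarrow> P_count x i j m * g i j)"
      by (simp add: eq)
  qed
  finally show ?thesis
    by simp
qed

text \<open>The equation \<open>m + p = n + 1\<close> eliminates \<open>p\<close>; positivity of
  \<open>m\<close> and \<open>p\<close> confines \<open>m\<close> to 1 up to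
  \<open>n\<close>.\<close>

lemma sum_sum_indices:
  "(\<Sum>(i, j, k, l, m, p) \<in> sum_indices n. f i j k l m p) =
   (\<Sum>m = 1..n. \<Sum>(i, j) \<in> last_columns m. \<Sum>(k, l) \<in> last_columns (n + 1 - m).
     f i j k l m (n + 1 - m))"
proof -
  have "(\<Sum>m = 1..n. \<Sum>(i, j) \<in> last_columns m. \<Sum>(k, l) \<in> last_columns (n + 1 - m).
      f i j k l m (n + 1 - m)) =
    (\<Sum>m = 1..n. \<Sum>((i, j), (k, l)) \<in> last_columns m \<times> last_columns (n + 1 - m).
      f i j k l m (n + 1 - m))"
    by (simp add: sum.cartesian_product case_prod_beta)
  also have "\<dots> = (\<Sum>(m, (i, j), (k, l)) \<in> (SIGMA m:{1..n}. last_columns m \<times> last_columns (n + 1 - m)).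
      f i j k l m (n + 1 - m))"
    by (subst sum.Sigma) (auto simp: case_prod_beta)
  also have "\<dots> = (\<Sum>(i, j, k, l, m, p) \<in> sum_indices n. f i j k l m p)"
    by (rule sum.reindex_bij_witness[
          where i = "\<lambda>(i, j, k, l, m, p). (m, (i, j), (k, l))"
            and j = "\<lambda>(m, (i, j), (k, l)). (i, j, k, l, m, n + 1 - m)"])
      (auto simp: sum_indices_def last_columns_def)
  finally show ?thesis ..
qed

theorem theorem4p9:
  fixes x y z n :: nat
  assumes "x \<in> {1..20}" and "z \<in> {1..20}" and "y \<in> {1..6}" and "n \<ge> 1"
  shows "s n (simple_piece x \<union> {B_piece y} \<union> (F1 \<circ> F2) ` simple_piece z) =
    (\<Sum>(i, j, k, l, m, p) \<in> sum_indices n.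
        P_count x i j m * T y i j k l m p * P_count z k l p)
    + s n (simple_piece x) + s n (simple_piece z)"
proof -
  let ?G = "simple_piece x" and ?H = "simple_piece z"
  let ?X = "split_lists n ?G (B_piece y) ((F1 \<circ> F2) ` ?H)"
  have G: "M $$ (1, t) < M $$ (0, t)" if "M \<in> ?G" "t < 2" for M t
    using A_piece_columns(1) simple_piece_subset[OF assms(1)] that by blast
  have H: "M $$ (0, t) < M $$ (1, t)" if M: "M \<in> (F1 \<circ> F2) ` ?H" and t: "t < 2" for M t
  proof -
    obtain N where N: "M = (F1 \<circ> F2) N" "N \<in> ?H"
      using M by (rule imageE)
    have "N $$ (1, 1 - t) < N $$ (0, 1 - t)"
      using A_piece_columns(1)[of N "1 - t"] simple_piece_subset[OF assms(2)] N(2) by auto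
    then show ?thesis
      using t by (simp add: N(1) F1_F2_index del: o_apply)
  qed
  have H_carrier: "?H \<subseteq> carrier_mat 2 2"
    using A_piece_columns(2)[of _ 0] simple_piece_subset[OF assms(2)] by auto
  have disjoint: "?X i \<inter> ?X j = {}" if "i \<in> {..n + 1}" "j \<in> {..n + 1}" "i \<noteq> j" for i j
  proof (rule ccontr)
    assume "?X i \<inter> ?X j \<noteq> {}"
    then obtain zs where zs: "zs \<in> ?X i" "zs \<in> ?X j"
      by blast
    have "c < i \<longleftrightarrow> c < j" if "c \<le> n" for c
      using up_column_split_lists[OF G B_piece_columns[OF assms(3)] H zs(1) assms(4) _ that]
        up_column_split_lists[OF G B_piece_columns[OF assms(3)] H zs(2) assms(4) _ that]
        \<open>i \<in> {..n + 1}\<close> \<open>j \<in> {..n + 1}\<close> by simp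
    \<comment> \<open>The smaller of two different indices is at most \<open>n\<close>, hence itself
      a column on which the two criteria disagree.\<close>
    from this[of i] this[of j] have "\<not> i < j" "\<not> j < i"
      using that(1,2) by fastforce+
    then show False
      using that(3) by simp
  qed
  have finite: "finite (?X m)" for m
    by (rule finite_subset[OF _ finite_cell_lists[of "n + 1"]]) (auto simp: split_lists_def)
  have middle: "card (?X m) = (\<Sum>(i, j) \<in> last_columns m. \<Sum>(k, l) \<in> last_columns (n + 1 - m).
      P_count x i j m * T y i j k l m (n + 1 - m) * P_count z k l (n + 1 - m))"
    if "m \<in> {1..n}" for m
  proof -
    let ?p = "n + 1 - m"
    have m: "1 \<le> m" "m \<le> n" "0 < m" "0 < ?p"
      using that by auto
    have "card (?X m) = (\<Sum>xs \<in> up_lists ?G m. \<Sum>ys \<in> up_lists ?H ?p.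
      T y (Suc (pos xs (1, m - 1))) (pos xs (0, m - 1) - pos xs (1, m - 1))
        (Suc (pos ys (1, ?p - 1))) (pos ys (0, ?p - 1) - pos ys (1, ?p - 1)) m ?p)"
      by (rule card_split_lists_middle[OF G H H_carrier assms(3) m(1,2) refl])
    \<comment> \<open>Grouping is done first by the last column of \<open>ys\<close>, then by that
      of \<open>xs\<close>, with the inner sum as the weight \<open>g\<close> of the outer
      one.\<close>
    also have "\<dots> = (\<Sum>xs \<in> up_lists ?G m. \<Sum>(k, l) \<in> last_columns ?p. P_count z k l ?p *
      T y (Suc (pos xs (1, m - 1))) (pos xs (0, m - 1) - pos xs (1, m - 1)) k l m ?p)"
      by (rule sum.cong[OF refl sum_up_lists[OF m(4)]])
    also have "\<dots> = (\<Sum>(i, j) \<in> last_columns m. P_count x i j m *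
      (\<Sum>(k, l) \<in> last_columns ?p. P_count z k l ?p * T y i j k l m ?p))"
      by (rule sum_up_lists[OF m(3)])
    also have "\<dots> = (\<Sum>(i, j) \<in> last_columns m. \<Sum>(k, l) \<in> last_columns ?p.
      P_count x i j m * T y i j k l m ?p * P_count z k l ?p)"
      by (simp add: sum_distrib_left case_prod_beta mult_ac)
    finally show ?thesis .
  qed
  have "s n (?G \<union> {B_piece y} \<union> (F1 \<circ> F2) ` ?H) = card (\<Union>m\<in>{..n + 1}. ?X m)"
    unfolding s_eq
    using support_lists_eq_UN_split_lists[OF G B_piece_columns[OF assms(3)] H] by (simp only:)
  also have "\<dots> = (\<Sum>m\<in>{..n + 1}. card (?X m))"
    by (rule card_UN_disjoint) (use disjoint finite in blast)+
  \<comment> \<open>The terms for \<open>0\<close> and \<open>n + 1\<close> have no transition piece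
    and become the two last summands.\<close>
  also have "{..n + 1} = insert 0 (insert (n + 1) {1..n})"
    by auto
  also have "(\<Sum>m\<in>insert 0 (insert (n + 1) {1..n}). card (?X m)) =
      card (?X 0) + (card (?X (n + 1)) + (\<Sum>m = 1..n. card (?X m)))"
    by (subst sum.insert; simp)+
  also have "card (?X 0) = s n ?H"
    unfolding s_eq by (rule card_split_lists_first[OF H_carrier])
  also have "card (?X (n + 1)) = s n ?G"
    unfolding s_eq split_lists_last ..
  also have "(\<Sum>m = 1..n. card (?X m)) = (\<Sum>(i, j, k, l, m, p) \<in> sum_indices n.
      P_count x i j m * T y i j k l m p * P_count z k l p)"
    unfolding sum_sum_indices by (rule sum.cong[OF refl middle])
  finally show ?thesis
    by simp
qed

end
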